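(* For any field $k$, the (ungraded) Manin universal coacting Hopf algebra $\mathcal H^\square(k[x])$ on the polynomial algebra $k[x]$ does not exist. That is, there is no pair $(H_0,\rho_0)$, where $H_0$ is a Hopf algebra over $k$ and $\rho_0\colon k[x]\to k[x]\otimes H_0$ is a unital $H_0$-coaction, such that for every Hopf algebra $H$ over $k$ and every unital $H$-coaction $\rho\colon k[x]\to k[x]\otimes H$ there exists a unique Hopf algebra homomorphism $\varphi\colon H_0\to H$ with $\rho=(\mathrm{id}_{k[x]}\otimes\varphi)\rho_0$.
   Context: For a Hopf algebra $H$ over a field $k$ and a unital $k$-algebra $A$, an $H$-coaction on $A$ is an algebra homomorphism $\rho\colon A\to A\otimes H$ that makes $A$ a right $H$-comodule; it is unital if $\rho(1_A)=1_A\otimes 1_H$. The Manin universal coacting Hopf algebra $\mathcal H^\square(A)$ on $A$ is a Hopf algebra with a unital coaction on $A$ that is universal (initial, in the sense spelled out in the claim) among all unital Hopf algebra coactions on $A$. Here $H$ need not be commutative. *)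

theory Defs
  imports "HOL-Algebra.UnivPoly"
begin

section \<open>Linear maps and algebras\<close>

definition linear_maps ::
  "[('k, 'm) ring_scheme, ('k, 'a, 'p) module_scheme, ('k, 'b, 'q) module_scheme] \<Rightarrow> ('a \<Rightarrow> 'b) set"
  where "linear_maps K M N = {f \<in> carrier M \<rightarrow> carrier N.
    (\<forall>x\<in>carrier M. \<forall>y\<in>carrier M. f (x \<oplus>\<^bsub>M\<^esub> y) = f x \<oplus>\<^bsub>N\<^esub> f y) \<and>
    (\<forall>c\<in>carrier K. \<forall>x\<in>carrier M. f (c \<odot>\<^bsub>M\<^esub> x) = c \<odot>\<^bsub>N\<^esub> f x)}"

text \<open>Associative unital algebras. The locale \<^locale>\<open>algebra\<close> of the library is not used because it
  requires commutativity.\<close>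

locale assoc_algebra = module K A + ring A for K (structure) and A (structure) +
  assumes smult_mult_left: "\<lbrakk>c \<in> carrier K; x \<in> carrier A; y \<in> carrier A\<rbrakk>
      \<Longrightarrow> (c \<odot>\<^bsub>A\<^esub> x) \<otimes>\<^bsub>A\<^esub> y = c \<odot>\<^bsub>A\<^esub> (x \<otimes>\<^bsub>A\<^esub> y)"
    and smult_mult_right: "\<lbrakk>c \<in> carrier K; x \<in> carrier A; y \<in> carrier A\<rbrakk>
      \<Longrightarrow> x \<otimes>\<^bsub>A\<^esub> (c \<odot>\<^bsub>A\<^esub> y) = c \<odot>\<^bsub>A\<^esub> (x \<otimes>\<^bsub>A\<^esub> y)"

text \<open>The ground ring as an algebra over itself.\<close>

definition self_algebra :: "('k, 'm) ring_scheme \<Rightarrow> ('k, 'k) module"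
  where "self_algebra K = \<lparr>carrier = carrier K, monoid.mult = monoid.mult K, one = one K,
    ring.zero = ring.zero K, ring.add = ring.add K, smult = monoid.mult K\<rparr>"

definition algebra_hom ::
  "[('k, 'm) ring_scheme, ('k, 'a, 'p) module_scheme, ('k, 'b, 'q) module_scheme] \<Rightarrow> ('a \<Rightarrow> 'b) set"
  where "algebra_hom K A B = ring_hom A B \<inter> linear_maps K A B"

section \<open>Tensor products\<close>

text \<open>The tensor product of the modules \<open>M\<close> and \<open>N\<close> is the free module on
  \<open>carrier M \<times> carrier N\<close> modulo the submodule generated by the bilinearity relations. The
  ring operations of \<open>free_module\<close> are irrelevant and left unspecified.\<close>

definition free_module :: "[('k, 'm) ring_scheme, 'x set] \<Rightarrow> ('k, 'x \<Rightarrow> 'k) module"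
  where "free_module K X =
    \<lparr>carrier = {f. (\<forall>x. f x \<in> carrier K) \<and> (\<forall>x. x \<notin> X \<longrightarrow> f x = \<zero>\<^bsub>K\<^esub>) \<and> finite {x. f x \<noteq> \<zero>\<^bsub>K\<^esub>}},
     monoid.mult = undefined, one = undefined,
     ring.zero = (\<lambda>x. \<zero>\<^bsub>K\<^esub>), ring.add = (\<lambda>f g x. f x \<oplus>\<^bsub>K\<^esub> g x), smult = (\<lambda>c f x. c \<otimes>\<^bsub>K\<^esub> f x)\<rparr>"

definition free_gen :: "[('k, 'm) ring_scheme, 'x] \<Rightarrow> 'x \<Rightarrow> 'k"
  where "free_gen K x = (\<lambda>y. if y = x then \<one>\<^bsub>K\<^esub> else \<zero>\<^bsub>K\<^esub>)"

definition bilinear_relations ::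
  "[('k, 'm) ring_scheme, ('k, 'a, 'p) module_scheme, ('k, 'b, 'q) module_scheme] \<Rightarrow> ('a \<times> 'b \<Rightarrow> 'k) set"
  where "bilinear_relations K M N =
    (let F = free_module K (carrier M \<times> carrier N); \<delta> = free_gen K in
      {\<delta> (x \<oplus>\<^bsub>M\<^esub> x', y) \<ominus>\<^bsub>F\<^esub> (\<delta> (x, y) \<oplus>\<^bsub>F\<^esub> \<delta> (x', y)) | x x' y.
          x \<in> carrier M \<and> x' \<in> carrier M \<and> y \<in> carrier N} \<union>
      {\<delta> (x, y \<oplus>\<^bsub>N\<^esub> y') \<ominus>\<^bsub>F\<^esub> (\<delta> (x, y) \<oplus>\<^bsub>F\<^esub> \<delta> (x, y')) | x y y'.
          x \<in> carrier M \<and> y \<in> carrier N \<and> y' \<in> carrier N} \<union>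
      {\<delta> (c \<odot>\<^bsub>M\<^esub> x, y) \<ominus>\<^bsub>F\<^esub> (c \<odot>\<^bsub>F\<^esub> \<delta> (x, y)) | c x y.
          c \<in> carrier K \<and> x \<in> carrier M \<and> y \<in> carrier N} \<union>
      {\<delta> (x, c \<odot>\<^bsub>N\<^esub> y) \<ominus>\<^bsub>F\<^esub> (c \<odot>\<^bsub>F\<^esub> \<delta> (x, y)) | c x y.
          c \<in> carrier K \<and> x \<in> carrier M \<and> y \<in> carrier N})"

definition tensor_kernel ::
  "[('k, 'm) ring_scheme, ('k, 'a, 'p) module_scheme, ('k, 'b, 'q) module_scheme] \<Rightarrow> ('a \<times> 'b \<Rightarrow> 'k) set"
  where "tensor_kernel K M N =
    \<Inter>{I. submodule I K (free_module K (carrier M \<times> carrier N)) \<and> bilinear_relations K M N \<subseteq> I}"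

definition tensor_module ::
  "[('k, 'm) ring_scheme, ('k, 'a, 'p) module_scheme, ('k, 'b, 'q) module_scheme]
    \<Rightarrow> ('k, ('a \<times> 'b \<Rightarrow> 'k) set) module"
  where "tensor_module K M N =
    (let F = free_module K (carrier M \<times> carrier N); I = tensor_kernel K M N in
     \<lparr>carrier = a_rcosets\<^bsub>F\<^esub> I, monoid.mult = undefined, one = undefined,
      ring.zero = I, ring.add = set_add F, smult = (\<lambda>c t. \<Union>f\<in>t. I +>\<^bsub>F\<^esub> (c \<odot>\<^bsub>F\<^esub> f))\<rparr>)"

definition pure_tensor ::
  "[('k, 'm) ring_scheme, ('k, 'a, 'p) module_scheme, ('k, 'b, 'q) module_scheme, 'a, 'b]
    \<Rightarrow> ('a \<times> 'b \<Rightarrow> 'k) set"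
  where "pure_tensor K M N x y =
    tensor_kernel K M N +>\<^bsub>free_module K (carrier M \<times> carrier N)\<^esub> free_gen K (x, y)"

text \<open>\<open>tensor_lift K P \<beta>\<close> is the linear map with values in \<open>P\<close> that a bilinear map \<open>\<beta>\<close>
  induces on a tensor product: it sends the class of \<open>f = \<Sum> f(x, y) (x, y)\<close> to
  \<open>\<Sum> f(x, y) \<beta> x y\<close>. It is meaningful for bilinear \<open>\<beta>\<close> only, where the value does not
  depend on \<open>f\<close>.\<close>

definition tensor_lift ::
  "[('k, 'm) ring_scheme, ('k, 'c, 'r) module_scheme, 'a \<Rightarrow> 'b \<Rightarrow> 'c, ('a \<times> 'b \<Rightarrow> 'k) set] \<Rightarrow> 'c"
  where "tensor_lift K P \<beta> t =
    the_elem ((\<lambda>f. \<Oplus>\<^bsub>P\<^esub>p\<in>{p. f p \<noteq> \<zero>\<^bsub>K\<^esub>}. f p \<odot>\<^bsub>P\<^esub> \<beta> (fst p) (snd p)) ` t)"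

text \<open>The multiplication is determined by
  \<open>(x \<otimes> y) (x' \<otimes> y') = x x' \<otimes> y y'\<close>.\<close>

definition tensor_algebra ::
  "[('k, 'm) ring_scheme, ('k, 'a, 'p) module_scheme, ('k, 'b, 'q) module_scheme]
    \<Rightarrow> ('k, ('a \<times> 'b \<Rightarrow> 'k) set) module"
  where "tensor_algebra K A B = (let T = tensor_module K A B in
    T\<lparr>monoid.mult := (\<lambda>s t. tensor_lift K T (\<lambda>x y. tensor_lift K T
         (\<lambda>x' y'. pure_tensor K A B (x \<otimes>\<^bsub>A\<^esub> x') (y \<otimes>\<^bsub>B\<^esub> y')) t) s),
      one := pure_tensor K A B \<one>\<^bsub>A\<^esub> \<one>\<^bsub>B\<^esub>\<rparr>)"

text \<open>\<open>tensor_map K M N f g\<close> is \<open>f \<otimes> g\<close> for linear maps \<open>f\<close> and \<open>g\<close> with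
  codomains \<open>M\<close> and \<open>N\<close>.\<close>

definition tensor_map ::
  "[('k, 'm) ring_scheme, ('k, 'c, 'p) module_scheme, ('k, 'd, 'q) module_scheme, 'a \<Rightarrow> 'c, 'b \<Rightarrow> 'd,
    ('a \<times> 'b \<Rightarrow> 'k) set] \<Rightarrow> ('c \<times> 'd \<Rightarrow> 'k) set"
  where "tensor_map K M N f g =
    tensor_lift K (tensor_module K M N) (\<lambda>x y. pure_tensor K M N (f x) (g y))"

text \<open>The canonical isomorphism \<open>(L \<otimes> M) \<otimes> N \<rightarrow> L \<otimes> (M \<otimes> N)\<close>.\<close>

definition tensor_assoc ::
  "[('k, 'm) ring_scheme, ('k, 'a, 'p) module_scheme, ('k, 'b, 'q) module_scheme,
    ('k, 'c, 'r) module_scheme, (('a \<times> 'b \<Rightarrow> 'k) set \<times> 'c \<Rightarrow> 'k) set]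
    \<Rightarrow> ('a \<times> ('b \<times> 'c \<Rightarrow> 'k) set \<Rightarrow> 'k) set"
  where "tensor_assoc K L M N =
    (let MN = tensor_module K M N; T = tensor_module K L MN in
     tensor_lift K T (\<lambda>t z. tensor_lift K T
       (\<lambda>x y. pure_tensor K L MN x (pure_tensor K M N y z)) t))"

section \<open>Hopf algebras and their coactions\<close>

record ('k, 'h) hopf = "('k, 'h) module" +
  comult :: "'h \<Rightarrow> ('h \<times> 'h \<Rightarrow> 'k) set"
  counit :: "'h \<Rightarrow> 'k"
  antipode :: "'h \<Rightarrow> 'h"

text \<open>Maps out of tensor products that end in \<open>K \<otimes> H\<close> or \<open>H \<otimes> K\<close> are written with
  these modules identified with \<open>H\<close>; likewise, the antipode axioms use the map
  \<open>x \<otimes> y \<mapsto> S(x) y\<close> instead of \<open>S \<otimes> id\<close> followed by the multiplication.\<close>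

locale hopf_algebra = field K + assoc_algebra K H
  for K :: "('k, 'm) ring_scheme" (structure) and H :: "('k, 'h) hopf" (structure) +
  assumes comult_hom: "comult H \<in> algebra_hom K H (tensor_algebra K H H)"
    and counit_hom: "counit H \<in> algebra_hom K H (self_algebra K)"
    and coassoc: "h \<in> carrier H \<Longrightarrow>
      tensor_assoc K H H H (tensor_map K (tensor_module K H H) H (comult H) (\<lambda>x. x) (comult H h)) =
      tensor_map K H (tensor_module K H H) (\<lambda>x. x) (comult H) (comult H h)"
    and counit_left: "h \<in> carrier H \<Longrightarrow>
      tensor_lift K H (\<lambda>x y. counit H x \<odot>\<^bsub>H\<^esub> y) (comult H h) = h"
    and counit_right: "h \<in> carrier H \<Longrightarrow>
      tensor_lift K H (\<lambda>x y. counit H y \<odot>\<^bsub>H\<^esub> x) (comult H h) = h"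
    and antipode_linear: "antipode H \<in> linear_maps K H H"
    and antipode_left: "h \<in> carrier H \<Longrightarrow>
      tensor_lift K H (\<lambda>x y. antipode H x \<otimes>\<^bsub>H\<^esub> y) (comult H h) = counit H h \<odot>\<^bsub>H\<^esub> \<one>\<^bsub>H\<^esub>"
    and antipode_right: "h \<in> carrier H \<Longrightarrow>
      tensor_lift K H (\<lambda>x y. x \<otimes>\<^bsub>H\<^esub> antipode H y) (comult H h) = counit H h \<odot>\<^bsub>H\<^esub> \<one>\<^bsub>H\<^esub>"

text \<open>Homomorphisms of Hopf algebras are the bialgebra homomorphisms; these commute with the
  antipodes automatically.\<close>

definition hopf_hom ::
  "[('k, 'm) ring_scheme, ('k, 'h) hopf, ('k, 'g) hopf] \<Rightarrow> ('h \<Rightarrow> 'g) set"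
  where "hopf_hom K H G = {\<phi> \<in> algebra_hom K H G. \<forall>h\<in>carrier H.
    comult G (\<phi> h) = tensor_map K G G \<phi> \<phi> (comult H h) \<and> counit G (\<phi> h) = counit H h}"

definition comodule_map ::
  "[('k, 'm) ring_scheme, ('k, 'a, 'p) module_scheme, ('k, 'h) hopf, 'a \<Rightarrow> ('a \<times> 'h \<Rightarrow> 'k) set] \<Rightarrow> bool"
  where "comodule_map K A H \<rho> \<longleftrightarrow>
    \<rho> \<in> linear_maps K A (tensor_module K A H) \<and>
    (\<forall>a\<in>carrier A.
      tensor_assoc K A H H (tensor_map K (tensor_module K A H) H \<rho> (\<lambda>h. h) (\<rho> a)) =
        tensor_map K A (tensor_module K H H) (\<lambda>x. x) (comult H) (\<rho> a) \<and>
      tensor_lift K A (\<lambda>x h. counit H h \<odot>\<^bsub>A\<^esub> x) (\<rho> a) = a)"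

text \<open>The condition that \<open>\<rho>\<close> maps \<open>1\<close> to \<open>1 \<otimes> 1\<close>, i.e. that the coaction is unital,
  is part of \<^const>\<open>algebra_hom\<close>.\<close>

definition unital_coaction ::
  "[('k, 'm) ring_scheme, ('k, 'a, 'p) module_scheme, ('k, 'h) hopf, 'a \<Rightarrow> ('a \<times> 'h \<Rightarrow> 'k) set] \<Rightarrow> bool"
  where "unital_coaction K A H \<rho> \<longleftrightarrow>
    \<rho> \<in> algebra_hom K A (tensor_algebra K A H) \<and> comodule_map K A H \<rho>"

text \<open>HOL cannot quantify over types inside a formula, so universality is tested on the Hopf algebras
  whose carrier is a subset of the type \<open>'u\<close>, which plays the role of a universe; the carrier of
  \<open>H0\<close> lies in an unrelated type. The notion is only sensible for a large enough \<open>'u\<close>: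
  if, say, \<open>K\<close> and \<open>'u\<close> both have two elements, then \<open>K\<close> is the only Hopf algebra in
  \<open>'u\<close> up to isomorphism, and \<open>K\<close> itself is universal among these. Maps are only relevant on
  carriers, so uniqueness is imposed within \<^const>\<open>extensional\<close>.\<close>

definition universal_coacting_hopf_algebra ::
  "['u itself, ('k, 'm) ring_scheme, ('k, 'a, 'p) module_scheme, ('k, 'h) hopf,
    'a \<Rightarrow> ('a \<times> 'h \<Rightarrow> 'k) set] \<Rightarrow> bool"
  where "universal_coacting_hopf_algebra (_ :: 'u itself) K A H0 \<rho>0 \<longleftrightarrow>
    hopf_algebra K H0 \<and> unital_coaction K A H0 \<rho>0 \<and>
    (\<forall>(H :: ('k, 'u) hopf) \<rho>. hopf_algebra K H \<and> unital_coaction K A H \<rho> \<longrightarrow>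
      (\<exists>!\<phi>. \<phi> \<in> hopf_hom K H0 H \<inter> extensional (carrier H0) \<and>
        (\<forall>a\<in>carrier A. \<rho> a = tensor_map K A H (\<lambda>x. x) \<phi> (\<rho>0 a))))"

end

theory Submission
  imports Defs
begin

text \<open>
  A universal coaction bounds degrees. If \<open>\<rho>0\<close> is universal, then
  \<open>\<rho>0(x) = \<Sum> p\<^sub>i \<otimes> h\<^sub>i\<close> is a finite sum, so for some \<open>b\<close> no \<open>p\<^sub>i\<close> involves a power of \<open>x\<close> beyond
  \<open>x\<^sup>b\<close>. Every other coaction is \<open>\<rho> = (id \<otimes> \<phi>) \<rho>0\<close>, so \<open>\<rho>(x)\<close> has degree at most \<open>b\<close> in \<open>x\<close> as well,
  with the same \<open>b\<close> for all \<open>\<rho>\<close>. It therefore suffices to produce, for every odd \<open>s\<close>, one coaction in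
  which \<open>\<rho>(x)\<close> has degree \<open>s + 1\<close>.

  One four-dimensional Hopf algebra does this over every field. Let \<open>H\<close> be the Sweedler algebra with
  basis \<open>1, g, y, z = g y\<close>, where
  \<open>g\<^sup>2 = 1\<close>, \<open>y\<^sup>2 = 0\<close>, \<open>y g = - g y\<close>, \<open>\<Delta>(g) = g \<otimes> g\<close> and \<open>\<Delta>(y) = y \<otimes> g + 1 \<otimes> y\<close>. These formulas define a
  Hopf algebra in every characteristic; it is commutative precisely in characteristic two.
  A coaction of \<open>H\<close> on \<open>k[x]\<close> is
  \<open>\<rho>(p) = p\<^sub>e \<otimes> 1 + p\<^sub>o \<otimes> g + x\<^sup>s p\<^sub>o \<otimes> y\<close>, where \<open>p\<^sub>e\<close> and \<open>p\<^sub>o\<close> are the even and odd parts of \<open>p\<close>. In particular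
  \<open>\<rho>(x) = x \<otimes> g + x\<^sup>s\<^sup>+\<^sup>1 \<otimes> y\<close>. It is multiplicative because the cross terms of
  \<open>\<rho>(p) \<rho>(q)\<close> in \<open>g y\<close> and \<open>y g\<close> cancel and \<open>y\<^sup>2 = 0\<close>; it is coassociative because \<open>x\<^sup>s p\<^sub>o\<close> is even, as \<open>s\<close> is odd,
  and hence coinvariant.

  The degree is read off with the linear maps \<open>tensor_coeff\<close>, which send \<open>p \<otimes> v\<close> to the product of \<open>v\<close> with the
  \<open>n\<close>-th coefficient of \<open>p\<close>. They vanish on a given tensor for all large \<open>n\<close>
  (\<open>tensor_degree_bounded\<close>) and commute with \<open>id \<otimes> \<phi>\<close> (\<open>tensor_coeff_natural\<close>). Only four coordinates in
  \<open>k\<close> are needed to write down \<open>H\<close>, so \<open>H\<close> can be realised in the universe of test algebras as soon as the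
  polynomials embed into it.

  Tensor products are concrete quotients of free modules. Their universal property
  (\<open>tensor_lift_linear\<close>, \<open>tensor_lift_pure\<close>, \<open>tensor_induct\<close>) reduces
  every identity between linear maps to one between pure tensors.
\<close>

section \<open>Linear maps\<close>

lemma linear_mapsI:
  assumes "\<And>x. x \<in> carrier M \<Longrightarrow> f x \<in> carrier N"
    and "\<And>x y. \<lbrakk>x \<in> carrier M; y \<in> carrier M\<rbrakk> \<Longrightarrow> f (x \<oplus>\<^bsub>M\<^esub> y) = f x \<oplus>\<^bsub>N\<^esub> f y"
    and "\<And>c x. \<lbrakk>c \<in> carrier K; x \<in> carrier M\<rbrakk> \<Longrightarrow> f (c \<odot>\<^bsub>M\<^esub> x) = c \<odot>\<^bsub>N\<^esub> f x"
  shows "f \<in> linear_maps K M N"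
  using assms by (auto simp: linear_maps_def)

lemma linear_mapsD:
  assumes "f \<in> linear_maps K M N"
  shows "\<And>x. x \<in> carrier M \<Longrightarrow> f x \<in> carrier N"
    and "\<And>x y. \<lbrakk>x \<in> carrier M; y \<in> carrier M\<rbrakk> \<Longrightarrow> f (x \<oplus>\<^bsub>M\<^esub> y) = f x \<oplus>\<^bsub>N\<^esub> f y"
    and "\<And>c x. \<lbrakk>c \<in> carrier K; x \<in> carrier M\<rbrakk> \<Longrightarrow> f (c \<odot>\<^bsub>M\<^esub> x) = c \<odot>\<^bsub>N\<^esub> f x"
  using assms by (auto simp: linear_maps_def)

lemma linear_map_zero:
  assumes "module K M" "module K N" "f \<in> linear_maps K M N"
  shows "f \<zero>\<^bsub>M\<^esub> = \<zero>\<^bsub>N\<^esub>"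
proof -
  interpret M: module K M by fact
  interpret N: module K N by fact
  have "f \<zero>\<^bsub>M\<^esub> = f (\<zero>\<^bsub>K\<^esub> \<odot>\<^bsub>M\<^esub> \<zero>\<^bsub>M\<^esub>)" by simp
  also have "\<dots> = \<zero>\<^bsub>N\<^esub>"
    using linear_mapsD[OF assms(3)] by (simp del: M.smult_l_null M.smult_r_null)
  finally show ?thesis .
qed

lemma linear_map_neg:
  assumes "module K M" "module K N" "f \<in> linear_maps K M N" "x \<in> carrier M"
  shows "f (\<ominus>\<^bsub>M\<^esub> x) = \<ominus>\<^bsub>N\<^esub> f x"
proof -
  interpret M: module K M by fact
  interpret N: module K N by fact
  have "f (\<ominus>\<^bsub>M\<^esub> x) \<oplus>\<^bsub>N\<^esub> f x = f (\<ominus>\<^bsub>M\<^esub> x \<oplus>\<^bsub>M\<^esub> x)"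
    using linear_mapsD(2)[OF assms(3)] assms(4) by simp
  also have "\<dots> = \<zero>\<^bsub>N\<^esub>"
    using linear_map_zero[OF assms(1-3)] assms(4) by (simp add: M.M.l_neg)
  finally show ?thesis
    using linear_mapsD(1)[OF assms(3)] assms(4) by (intro N.M.minus_equality[symmetric]) auto
qed

lemma linear_map_minus:
  assumes "module K M" "module K N" "f \<in> linear_maps K M N" "x \<in> carrier M" "y \<in> carrier M"
  shows "f (x \<ominus>\<^bsub>M\<^esub> y) = f x \<ominus>\<^bsub>N\<^esub> f y"
proof -
  interpret M: module K M by fact
  show ?thesis
    using linear_mapsD(2)[OF assms(3)] linear_map_neg[OF assms(1-3)] assms(4,5)
    by (simp add: a_minus_def)
qed

lemma linear_maps_id: "(\<lambda>x. x) \<in> linear_maps K M M"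
  by (auto simp: linear_maps_def)

lemma linear_maps_comp:
  "\<lbrakk>f \<in> linear_maps K L M; h \<in> linear_maps K M N\<rbrakk> \<Longrightarrow> (\<lambda>x. h (f x)) \<in> linear_maps K L N"
  by (auto simp: linear_maps_def Pi_iff)

section \<open>Free modules\<close>

text \<open>The sum in \<^const>\<open>tensor_lift\<close> before passing to cosets. It is stated for an arbitrary index set because
  neither its linearity nor its values on generators depend on the product structure.\<close>

definition free_lift ::
  "[('k, 'm) ring_scheme, ('k, 'c, 'r) module_scheme, 'x \<Rightarrow> 'c, 'x \<Rightarrow> 'k] \<Rightarrow> 'c"
  where "free_lift K P b f = (\<Oplus>\<^bsub>P\<^esub>p\<in>{p. f p \<noteq> \<zero>\<^bsub>K\<^esub>}. f p \<odot>\<^bsub>P\<^esub> b p)"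

lemma free_module_sel:
  "f \<in> carrier (free_module K X) \<longleftrightarrow>
     (\<forall>x. f x \<in> carrier K) \<and> (\<forall>x. x \<notin> X \<longrightarrow> f x = \<zero>\<^bsub>K\<^esub>) \<and> finite {x. f x \<noteq> \<zero>\<^bsub>K\<^esub>}"
  "\<zero>\<^bsub>free_module K X\<^esub> = (\<lambda>x. \<zero>\<^bsub>K\<^esub>)"
  "f \<oplus>\<^bsub>free_module K X\<^esub> h = (\<lambda>x. f x \<oplus>\<^bsub>K\<^esub> h x)"
  "c \<odot>\<^bsub>free_module K X\<^esub> f = (\<lambda>x. c \<otimes>\<^bsub>K\<^esub> f x)"
  by (auto simp: free_module_def)

lemma free_gen_closed:
  assumes "cring K" "x \<in> X"
  shows "free_gen K x \<in> carrier (free_module K X)"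
proof -
  interpret cring K by fact
  have "finite {y. free_gen K x y \<noteq> \<zero>\<^bsub>K\<^esub>}"
    by (rule finite_subset[of _ "{x}"]) (auto simp: free_gen_def)
  then show ?thesis using assms(2) by (auto simp: free_module_sel free_gen_def)
qed

lemma free_module_add_closed:
  assumes "cring K" "f \<in> carrier (free_module K X)" "h \<in> carrier (free_module K X)"
  shows "(\<lambda>x. f x \<oplus>\<^bsub>K\<^esub> h x) \<in> carrier (free_module K X)"
proof -
  interpret cring K by fact
  have "finite {x. f x \<oplus>\<^bsub>K\<^esub> h x \<noteq> \<zero>\<^bsub>K\<^esub>}"
    by (rule finite_subset[of _ "{x. f x \<noteq> \<zero>\<^bsub>K\<^esub>} \<union> {x. h x \<noteq> \<zero>\<^bsub>K\<^esub>}"])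
      (use assms in \<open>auto simp: free_module_sel\<close>)
  then show ?thesis using assms by (auto simp: free_module_sel)
qed

lemma free_module_smult_closed:
  assumes "cring K" "c \<in> carrier K" "f \<in> carrier (free_module K X)"
  shows "(\<lambda>x. c \<otimes>\<^bsub>K\<^esub> f x) \<in> carrier (free_module K X)"
proof -
  interpret cring K by fact
  have "finite {x. c \<otimes>\<^bsub>K\<^esub> f x \<noteq> \<zero>\<^bsub>K\<^esub>}"
    by (rule finite_subset[of _ "{x. f x \<noteq> \<zero>\<^bsub>K\<^esub>}"])
      (use assms in \<open>auto simp: free_module_sel\<close>)
  then show ?thesis using assms by (auto simp: free_module_sel)
qed

lemma free_module_module:
  assumes "cring K"
  shows "module K (free_module K X)"
proof -
  interpret cring K by fact
  let ?F = "free_module K X"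
  have K: "f x \<in> carrier K" if "f \<in> carrier ?F" for f x
    using that by (simp add: free_module_sel)
  have "abelian_group ?F"
  proof (rule abelian_groupI)
    fix f assume f: "f \<in> carrier ?F"
    show "\<exists>h\<in>carrier ?F. h \<oplus>\<^bsub>?F\<^esub> f = \<zero>\<^bsub>?F\<^esub>"
      by (rule bexI[OF _ free_module_smult_closed[OF assms, of "\<ominus>\<^bsub>K\<^esub> \<one>\<^bsub>K\<^esub>" f]])
        (use f in \<open>auto simp: free_module_sel(2-4) K l_minus l_neg\<close>)
  qed (auto simp: free_module_sel(2-4) free_module_add_closed assms K a_ac intro!: ext,
      auto simp: free_module_sel)
  then show ?thesis
    by (intro moduleI assms)
      (auto simp: free_module_sel(2-4) free_module_smult_closed assms K l_distr r_distr m_assoc)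
qed

text \<open>Two elements of the free module have different supports, so their sums can only be compared over a common
  finite index set.\<close>

lemma free_lift_superset:
  assumes "module K P" "finite S" "S \<subseteq> X" "{x. f x \<noteq> \<zero>\<^bsub>K\<^esub>} \<subseteq> S"
    and "f \<in> carrier (free_module K X)" and "\<And>x. x \<in> X \<Longrightarrow> b x \<in> carrier P"
  shows "free_lift K P b f = (\<Oplus>\<^bsub>P\<^esub>p\<in>S. f p \<odot>\<^bsub>P\<^esub> b p)"
proof -
  interpret module K P by fact
  show ?thesis unfolding free_lift_def
    by (rule M.add.finprod_mono_neutral_cong_left)
      (use assms in \<open>auto simp: free_module_sel Pi_iff subset_iff\<close>)
qed

lemma free_lift_closed:
  assumes "module K P" and "f \<in> carrier (free_module K X)" and "\<And>x. x \<in> X \<Longrightarrow> b x \<in> carrier P"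
  shows "free_lift K P b f \<in> carrier P"
proof -
  interpret module K P by fact
  show ?thesis unfolding free_lift_def
    by (rule M.finsum_closed) (use assms in \<open>auto simp: free_module_sel\<close>)
qed

lemma free_lift_add:
  assumes "module K P" and "f \<in> carrier (free_module K X)" "h \<in> carrier (free_module K X)"
    and b: "\<And>x. x \<in> X \<Longrightarrow> b x \<in> carrier P"
  shows "free_lift K P b (f \<oplus>\<^bsub>free_module K X\<^esub> h) = free_lift K P b f \<oplus>\<^bsub>P\<^esub> free_lift K P b h"
proof -
  interpret module K P by fact
  let ?S = "{x. f x \<noteq> \<zero>\<^bsub>K\<^esub>} \<union> {x. h x \<noteq> \<zero>\<^bsub>K\<^esub>}"
  let ?F = "free_module K X"
  have S: "finite ?S" "?S \<subseteq> X" using assms by (auto simp: free_module_sel)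
  interpret F: module K ?F by (rule free_module_module[OF R.is_cring])
  have K: "f x \<in> carrier K" "h x \<in> carrier K" for x
    using assms by (auto simp: free_module_sel)
  have sup: "{x. (f \<oplus>\<^bsub>?F\<^esub> h) x \<noteq> \<zero>\<^bsub>K\<^esub>} \<subseteq> ?S"
    using K by (auto simp: free_module_sel)
  have "free_lift K P b (f \<oplus>\<^bsub>?F\<^esub> h) = (\<Oplus>\<^bsub>P\<^esub>p\<in>?S. (f \<oplus>\<^bsub>?F\<^esub> h) p \<odot>\<^bsub>P\<^esub> b p)"
    by (rule free_lift_superset[OF assms(1) S sup]) (use assms in auto)
  also have "\<dots> = (\<Oplus>\<^bsub>P\<^esub>p\<in>?S. f p \<odot>\<^bsub>P\<^esub> b p \<oplus>\<^bsub>P\<^esub> h p \<odot>\<^bsub>P\<^esub> b p)"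
    by (rule M.finsum_cong') (use S b K in \<open>auto simp: free_module_sel smult_l_distr\<close>)
  also have "\<dots> = (\<Oplus>\<^bsub>P\<^esub>p\<in>?S. f p \<odot>\<^bsub>P\<^esub> b p) \<oplus>\<^bsub>P\<^esub> (\<Oplus>\<^bsub>P\<^esub>p\<in>?S. h p \<odot>\<^bsub>P\<^esub> b p)"
    by (rule M.finsum_addf) (use S b K in auto)
  also have "(\<Oplus>\<^bsub>P\<^esub>p\<in>?S. f p \<odot>\<^bsub>P\<^esub> b p) = free_lift K P b f"
    by (rule free_lift_superset[OF assms(1) S, symmetric]) (use assms in auto)
  also have "(\<Oplus>\<^bsub>P\<^esub>p\<in>?S. h p \<odot>\<^bsub>P\<^esub> b p) = free_lift K P b h"
    by (rule free_lift_superset[OF assms(1) S, symmetric]) (use assms in auto)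
  finally show ?thesis .
qed

lemma free_lift_smult:
  assumes "module K P" and "c \<in> carrier K" and "f \<in> carrier (free_module K X)"
    and b: "\<And>x. x \<in> X \<Longrightarrow> b x \<in> carrier P"
  shows "free_lift K P b (c \<odot>\<^bsub>free_module K X\<^esub> f) = c \<odot>\<^bsub>P\<^esub> free_lift K P b f"
proof -
  interpret module K P by fact
  let ?S = "{x. f x \<noteq> \<zero>\<^bsub>K\<^esub>}"
  let ?F = "free_module K X"
  have S: "finite ?S" "?S \<subseteq> X" using assms by (auto simp: free_module_sel)
  interpret F: module K ?F by (rule free_module_module[OF R.is_cring])
  have K: "f x \<in> carrier K" for x
    using assms by (auto simp: free_module_sel)
  have sup: "{x. (c \<odot>\<^bsub>?F\<^esub> f) x \<noteq> \<zero>\<^bsub>K\<^esub>} \<subseteq> ?S"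
    using K assms(2) by (auto simp: free_module_sel)
  have "free_lift K P b (c \<odot>\<^bsub>?F\<^esub> f) = (\<Oplus>\<^bsub>P\<^esub>p\<in>?S. (c \<odot>\<^bsub>?F\<^esub> f) p \<odot>\<^bsub>P\<^esub> b p)"
    by (rule free_lift_superset[OF assms(1) S sup]) (use assms in auto)
  also have "\<dots> = (\<Oplus>\<^bsub>P\<^esub>p\<in>?S. c \<odot>\<^bsub>P\<^esub> (f p \<odot>\<^bsub>P\<^esub> b p))"
    by (rule M.finsum_cong') (use S b K assms(2) in \<open>auto simp: free_module_sel smult_assoc1\<close>)
  also have "\<dots> = c \<odot>\<^bsub>P\<^esub> free_lift K P b f"
    unfolding free_lift_def
    by (rule finsum_smult_ldistr[symmetric]) (use S b K assms(2) in auto)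
  finally show ?thesis .
qed

text \<open>Over the zero ring a generator has empty support; then \<open>P\<close> is zero as well, which is why that case
  still holds.\<close>

lemma free_lift_gen:
  assumes "module K P" "x \<in> X" and b: "b x \<in> carrier P"
  shows "free_lift K P b (free_gen K x) = b x"
proof (cases "\<one>\<^bsub>K\<^esub> = \<zero>\<^bsub>K\<^esub>")
  interpret module K P by fact
  case True
  then have "b x = \<zero>\<^bsub>P\<^esub>" using b smult_l_null smult_one by metis
  with True show ?thesis by (simp add: free_lift_def free_gen_def)
next
  interpret module K P by fact
  case False
  then have "{y. free_gen K x y \<noteq> \<zero>\<^bsub>K\<^esub>} = {x}" by (auto simp: free_gen_def)
  then show ?thesis using b
    by (simp add: free_lift_def free_gen_def)
qed

lemma free_module_induct:
  assumes "cring K" and "f \<in> carrier (free_module K X)"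
    and zero: "Q \<zero>\<^bsub>free_module K X\<^esub>"
    and step: "\<And>c x h. \<lbrakk>c \<in> carrier K; x \<in> X; h \<in> carrier (free_module K X); Q h\<rbrakk>
      \<Longrightarrow> Q (c \<odot>\<^bsub>free_module K X\<^esub> free_gen K x \<oplus>\<^bsub>free_module K X\<^esub> h)"
  shows "Q f"
proof -
  interpret cring K by fact
  let ?F = "free_module K X"
  have "finite {x. f x \<noteq> \<zero>\<^bsub>K\<^esub>}" using assms(2) by (auto simp: free_module_sel)
  then show ?thesis using assms(2)
  proof (induction "{x. f x \<noteq> \<zero>\<^bsub>K\<^esub>}" arbitrary: f rule: finite_induct)
    case empty
    then have "f = \<zero>\<^bsub>?F\<^esub>" by (auto simp: free_module_sel)
    then show ?case using zero by simp
  next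
    case (insert x S)
    let ?h = "f(x := \<zero>\<^bsub>K\<^esub>)"
    have S: "S = {y. ?h y \<noteq> \<zero>\<^bsub>K\<^esub>}" using insert.hyps by auto
    have fK: "\<And>y. f y \<in> carrier K" using insert.prems by (auto simp: free_module_sel)
    have h: "?h \<in> carrier ?F"
      using insert.prems insert.hyps(1) S fK by (auto simp: free_module_sel)
    have x: "x \<in> X" using insert.prems insert.hyps(4) by (auto simp: free_module_sel)
    have "f = f x \<odot>\<^bsub>?F\<^esub> free_gen K x \<oplus>\<^bsub>?F\<^esub> ?h"
      using fK by (auto simp: free_module_sel free_gen_def fun_eq_iff)
    with step[OF fK[of x] x h insert.hyps(3)[OF S h]] show ?case by simp
  qed
qed

section \<open>The universal property of the tensor product\<close>

definition bilinear_maps ::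
  "[('k, 'm) ring_scheme, ('k, 'a, 'p) module_scheme, ('k, 'b, 'q) module_scheme,
    ('k, 'c, 'r) module_scheme] \<Rightarrow> ('a \<Rightarrow> 'b \<Rightarrow> 'c) set"
  where "bilinear_maps K M N P = {\<beta>.
    (\<forall>x\<in>carrier M. \<beta> x \<in> linear_maps K N P) \<and> (\<forall>y\<in>carrier N. (\<lambda>x. \<beta> x y) \<in> linear_maps K M P)}"

lemma bilinear_mapsI:
  assumes "\<And>x. x \<in> carrier M \<Longrightarrow> \<beta> x \<in> linear_maps K N P"
    and "\<And>y. y \<in> carrier N \<Longrightarrow> (\<lambda>x. \<beta> x y) \<in> linear_maps K M P"
  shows "\<beta> \<in> bilinear_maps K M N P"
  using assms by (auto simp: bilinear_maps_def)

lemma bilinear_mapsD: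
  assumes "\<beta> \<in> bilinear_maps K M N P"
  shows "x \<in> carrier M \<Longrightarrow> \<beta> x \<in> linear_maps K N P"
    and "y \<in> carrier N \<Longrightarrow> (\<lambda>x. \<beta> x y) \<in> linear_maps K M P"
  using assms by (auto simp: bilinear_maps_def)

lemma bilinear_maps_closed:
  "\<lbrakk>\<beta> \<in> bilinear_maps K M N P; x \<in> carrier M; y \<in> carrier N\<rbrakk> \<Longrightarrow> \<beta> x y \<in> carrier P"
  by (auto simp: bilinear_maps_def linear_maps_def)

text \<open>The quotient \<open>T\<close> of the free module \<open>F\<close> is always handled through the surjection \<open>cls\<close>: the operations of \<open>T\<close>
  are given on cosets, and the lemmas \<open>tensor_zero\<close>, \<open>tensor_add\<close> and \<open>tensor_smult\<close> say that \<open>cls\<close> is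
  linear, so that the module axioms pass from \<open>F\<close> to \<open>T\<close>.\<close>

locale tensor_pair = M: module K M + N: module K N
  for K :: "('k, 'm) ring_scheme" and M :: "('k, 'a, 'p) module_scheme"
    and N :: "('k, 'b, 'q) module_scheme"
begin

abbreviation "F \<equiv> free_module K (carrier M \<times> carrier N)"
abbreviation "I \<equiv> tensor_kernel K M N"
abbreviation "T \<equiv> tensor_module K M N"
abbreviation "cls f \<equiv> I +>\<^bsub>F\<^esub> f"

sublocale F: module K F by (rule free_module_module[OF M.R.is_cring])

lemma gen_closed: "\<lbrakk>x \<in> carrier M; y \<in> carrier N\<rbrakk> \<Longrightarrow> free_gen K (x, y) \<in> carrier F"
  by (rule free_gen_closed[OF M.R.is_cring]) simp

lemma bilinear_relations_subset: "bilinear_relations K M N \<subseteq> carrier F"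
  unfolding bilinear_relations_def Let_def
  by (auto intro!: F.M.minus_closed gen_closed F.M.a_closed F.smult_closed)

lemma kernel_submodule: "submodule I K F"
proof (rule F.submoduleI)
  let ?\<J> = "{I. submodule I K F \<and> bilinear_relations K M N \<subseteq> I}"
  have "carrier F \<in> ?\<J>" using F.carrier_is_submodule bilinear_relations_subset by auto
  then show "I \<subseteq> carrier F" unfolding tensor_kernel_def by auto
  show "\<zero>\<^bsub>F\<^esub> \<in> I" unfolding tensor_kernel_def
    using subgroup.one_closed[OF submodule.axioms(1)] by fastforce
qed (unfold tensor_kernel_def, auto dest: F.submoduleE)

lemma relations_in_kernel: "bilinear_relations K M N \<subseteq> I"
  unfolding tensor_kernel_def by auto

lemma kernel_least: "\<lbrakk>submodule J K F; bilinear_relations K M N \<subseteq> J\<rbrakk> \<Longrightarrow> I \<subseteq> J"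
  unfolding tensor_kernel_def by auto

sublocale I: abelian_subgroup I F
  by (rule abelian_subgroupI3[OF additive_subgroup.intro F.M.abelian_group_axioms])
    (rule submodule.axioms(1)[OF kernel_submodule])

lemma kernel_smult: "\<lbrakk>c \<in> carrier K; f \<in> I\<rbrakk> \<Longrightarrow> c \<odot>\<^bsub>F\<^esub> f \<in> I"
  using submodule.smult_closed[OF kernel_submodule] by blast

lemma cls_eq_iff:
  assumes "f \<in> carrier F" "h \<in> carrier F"
  shows "cls f = cls h \<longleftrightarrow> f \<ominus>\<^bsub>F\<^esub> h \<in> I"
proof -
  have "cls f = cls h \<longleftrightarrow> f \<in> cls h"
    using I.a_rcos_self[OF assms(1)] I.a_repr_independence'[of f h] assms by auto
  also have "\<dots> \<longleftrightarrow> f \<ominus>\<^bsub>F\<^esub> h \<in> I"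
    using I.a_rcos_module[OF assms(2,1)] by (simp add: a_minus_def)
  finally show ?thesis .
qed

lemma in_cls_iff:
  assumes "f \<in> carrier F"
  shows "h \<in> cls f \<longleftrightarrow> h \<in> carrier F \<and> h \<ominus>\<^bsub>F\<^esub> f \<in> I"
  using I.a_rcos_module[OF assms, of h] I.a_elemrcos_carrier[OF assms, of h]
  by (auto simp: a_minus_def)

lemma tensor_carrier: "carrier T = cls ` carrier F"
  by (auto simp: tensor_module_def Let_def A_RCOSETS_def')

lemma tensor_zero: "\<zero>\<^bsub>T\<^esub> = cls \<zero>\<^bsub>F\<^esub>"
  using F.M.a_coset_add_zero[OF I.a_subset] by (simp add: tensor_module_def Let_def)

lemma tensor_add:
  assumes "f \<in> carrier F" "h \<in> carrier F"
  shows "cls f \<oplus>\<^bsub>T\<^esub> cls h = cls (f \<oplus>\<^bsub>F\<^esub> h)"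
  using I.a_rcos_sum[OF assms] by (simp add: tensor_module_def Let_def)

lemma smult_minus_distrib:
  assumes "c \<in> carrier K" "f \<in> carrier F" "h \<in> carrier F"
  shows "c \<odot>\<^bsub>F\<^esub> (f \<ominus>\<^bsub>F\<^esub> h) = c \<odot>\<^bsub>F\<^esub> f \<ominus>\<^bsub>F\<^esub> c \<odot>\<^bsub>F\<^esub> h"
  using assms by (simp add: a_minus_def F.smult_r_distr F.smult_r_minus)

text \<open>The scalar action on a coset is a union over its representatives; since the kernel is stable under scalars,
  all of them contribute the same coset.\<close>

lemma tensor_smult:
  assumes "c \<in> carrier K" "f \<in> carrier F"
  shows "c \<odot>\<^bsub>T\<^esub> cls f = cls (c \<odot>\<^bsub>F\<^esub> f)"
proof -
  have "cls (c \<odot>\<^bsub>F\<^esub> h) = cls (c \<odot>\<^bsub>F\<^esub> f)" if "h \<in> cls f" for h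
    using that assms kernel_smult[OF assms(1)]
    by (subst cls_eq_iff) (auto simp: in_cls_iff smult_minus_distrib[symmetric])
  then have "(\<Union>h\<in>cls f. cls (c \<odot>\<^bsub>F\<^esub> h)) = cls (c \<odot>\<^bsub>F\<^esub> f)"
    using I.a_rcos_self[OF assms(2)] by blast
  then show ?thesis by (simp add: tensor_module_def Let_def)
qed

lemma tensor_module_module: "module K T"
proof -
  have "abelian_group T"
  proof (rule abelian_groupI)
    fix t assume "t \<in> carrier T"
    then obtain f where f: "f \<in> carrier F" "t = cls f" by (auto simp: tensor_carrier)
    show "\<exists>s\<in>carrier T. s \<oplus>\<^bsub>T\<^esub> t = \<zero>\<^bsub>T\<^esub>"
      by (rule bexI[of _ "cls (\<ominus>\<^bsub>F\<^esub> f)"])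
        (use f in \<open>auto simp: tensor_carrier tensor_add tensor_zero F.M.l_neg\<close>)
  qed (auto simp: tensor_carrier tensor_add tensor_zero F.M.a_ac)
  then show ?thesis
    by (intro moduleI M.R.is_cring)
      (auto simp: tensor_carrier tensor_add tensor_smult F.smult_l_distr F.smult_r_distr F.smult_assoc1)
qed

sublocale T: module K T by (rule tensor_module_module)

lemma pure_tensor_cls: "pure_tensor K M N x y = cls (free_gen K (x, y))"
  by (simp add: pure_tensor_def)

lemma pure_tensor_closed:
  "\<lbrakk>x \<in> carrier M; y \<in> carrier N\<rbrakk> \<Longrightarrow> pure_tensor K M N x y \<in> carrier T"
  by (auto simp: pure_tensor_cls tensor_carrier gen_closed)

lemma pure_tensor_bilinear: "pure_tensor K M N \<in> bilinear_maps K M N T"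
proof -
  have rel: "cls f = cls h"
    if "f \<ominus>\<^bsub>F\<^esub> h \<in> bilinear_relations K M N" "f \<in> carrier F" "h \<in> carrier F" for f h
    using that relations_in_kernel by (subst cls_eq_iff) auto
  show ?thesis
  proof (intro bilinear_mapsI linear_mapsI; unfold pure_tensor_cls)
    fix x y assume xy: "x \<in> carrier M" "y \<in> carrier N"
    then show "cls (free_gen K (x, y)) \<in> carrier T" "cls (free_gen K (x, y)) \<in> carrier T"
      by (auto simp: tensor_carrier gen_closed)
    show "cls (free_gen K (x \<oplus>\<^bsub>M\<^esub> x', y)) = cls (free_gen K (x, y)) \<oplus>\<^bsub>T\<^esub> cls (free_gen K (x', y))"
      if "x' \<in> carrier M" for x'
    proof -
      have "free_gen K (x \<oplus>\<^bsub>M\<^esub> x', y) \<ominus>\<^bsub>F\<^esub> (free_gen K (x, y) \<oplus>\<^bsub>F\<^esub> free_gen K (x', y))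
          \<in> bilinear_relations K M N"
        unfolding bilinear_relations_def Let_def using xy that by blast
      then show ?thesis using xy that by (simp add: rel tensor_add gen_closed)
    qed
    show "cls (free_gen K (x, y \<oplus>\<^bsub>N\<^esub> y')) = cls (free_gen K (x, y)) \<oplus>\<^bsub>T\<^esub> cls (free_gen K (x, y'))"
      if "y' \<in> carrier N" for y'
    proof -
      have "free_gen K (x, y \<oplus>\<^bsub>N\<^esub> y') \<ominus>\<^bsub>F\<^esub> (free_gen K (x, y) \<oplus>\<^bsub>F\<^esub> free_gen K (x, y'))
          \<in> bilinear_relations K M N"
        unfolding bilinear_relations_def Let_def using xy that by blast
      then show ?thesis using xy that by (simp add: rel tensor_add gen_closed)
    qed
    fix c assume c: "c \<in> carrier K"
    have "free_gen K (c \<odot>\<^bsub>M\<^esub> x, y) \<ominus>\<^bsub>F\<^esub> (c \<odot>\<^bsub>F\<^esub> free_gen K (x, y)) \<in> bilinear_relations K M N"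
      "free_gen K (x, c \<odot>\<^bsub>N\<^esub> y) \<ominus>\<^bsub>F\<^esub> (c \<odot>\<^bsub>F\<^esub> free_gen K (x, y)) \<in> bilinear_relations K M N"
      unfolding bilinear_relations_def Let_def using xy c by blast+
    then show "cls (free_gen K (c \<odot>\<^bsub>M\<^esub> x, y)) = c \<odot>\<^bsub>T\<^esub> cls (free_gen K (x, y))"
      "cls (free_gen K (x, c \<odot>\<^bsub>N\<^esub> y)) = c \<odot>\<^bsub>T\<^esub> cls (free_gen K (x, y))"
      using xy c by (simp_all add: rel tensor_smult gen_closed)
  qed
qed

text \<open>The elements of \<open>F\<close> annihilated by the lift form a submodule, and bilinearity puts the relations into it. The
  tensor kernel is the least such submodule.\<close>

lemma free_lift_kernel:
  assumes P: "module K P" and b: "\<beta> \<in> bilinear_maps K M N P" and "f \<in> I"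
  shows "free_lift K P (\<lambda>p. \<beta> (fst p) (snd p)) f = \<zero>\<^bsub>P\<^esub>"
proof -
  interpret P: module K P by fact
  let ?L = "free_lift K P (\<lambda>p. \<beta> (fst p) (snd p))"
  have b': "\<And>p. p \<in> carrier M \<times> carrier N \<Longrightarrow> \<beta> (fst p) (snd p) \<in> carrier P"
    using b by (auto intro: bilinear_maps_closed)
  have L: "?L \<in> linear_maps K F P"
    by (intro linear_mapsI free_lift_closed[OF P] free_lift_add[OF P] free_lift_smult[OF P] b')
  have gen: "?L (free_gen K (x, y)) = \<beta> x y" if "x \<in> carrier M" "y \<in> carrier N" for x y
    using free_lift_gen[OF P, of "(x, y)" "carrier M \<times> carrier N"] b' that by auto
  let ?J = "{f \<in> carrier F. ?L f = \<zero>\<^bsub>P\<^esub>}"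
  have "submodule ?J K F"
    by (rule F.submoduleI)
      (auto simp: linear_map_zero[OF F.module_axioms P L] linear_mapsD[OF L]
        linear_map_neg[OF F.module_axioms P L])
  moreover have "bilinear_relations K M N \<subseteq> ?J"
    unfolding bilinear_relations_def Let_def
    using bilinear_mapsD[OF b, THEN linear_mapsD(1)] bilinear_mapsD[OF b, THEN linear_mapsD(2)]
      bilinear_mapsD[OF b, THEN linear_mapsD(3)]
    by (auto simp: linear_map_minus[OF F.module_axioms P L] linear_mapsD[OF L] gen gen_closed 
        P.M.minus_eq P.M.r_neg)
  ultimately have "I \<subseteq> ?J" by (rule kernel_least)
  then show ?thesis using assms(3) by auto
qed

text \<open>By the previous lemma the lift is constant on a coset, so \<^const>\<open>the_elem\<close> in the definition of
  \<^const>\<open>tensor_lift\<close> is applied to a singleton.\<close>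

lemma tensor_lift_cls:
  assumes P: "module K P" and b: "\<beta> \<in> bilinear_maps K M N P" and f: "f \<in> carrier F"
  shows "tensor_lift K P \<beta> (cls f) = free_lift K P (\<lambda>p. \<beta> (fst p) (snd p)) f"
proof -
  interpret P: module K P by fact
  let ?L = "free_lift K P (\<lambda>p. \<beta> (fst p) (snd p))"
  have b': "\<And>p. p \<in> carrier M \<times> carrier N \<Longrightarrow> \<beta> (fst p) (snd p) \<in> carrier P"
    using b by (auto intro: bilinear_maps_closed)
  have L: "?L \<in> linear_maps K F P"
    by (intro linear_mapsI free_lift_closed[OF P] free_lift_add[OF P] free_lift_smult[OF P] b')
  have "?L h = ?L f" if "h \<in> cls f" for h
  proof -
    have h: "h \<in> carrier F" "h \<ominus>\<^bsub>F\<^esub> f \<in> I" using that in_cls_iff[OF f] by auto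
    from free_lift_kernel[OF P b h(2)] have "?L h \<ominus>\<^bsub>P\<^esub> ?L f = \<zero>\<^bsub>P\<^esub>"
      using linear_map_minus[OF F.module_axioms P L h(1) f] by simp
    then show ?thesis
      using linear_mapsD(1)[OF L h(1)] linear_mapsD(1)[OF L f] P.M.minus_equality[of "?L h" "\<ominus>\<^bsub>P\<^esub> ?L f"]
      by (simp add: P.M.minus_eq)
  qed
  then have "?L ` cls f = {?L f}" using I.a_rcos_self[OF f] by blast
  then show ?thesis unfolding tensor_lift_def free_lift_def[symmetric] by simp
qed

lemma tensor_lift_linear:
  assumes P: "module K P" and b: "\<beta> \<in> bilinear_maps K M N P"
  shows "tensor_lift K P \<beta> \<in> linear_maps K T P"
proof -
  have b': "\<And>p. p \<in> carrier M \<times> carrier N \<Longrightarrow> \<beta> (fst p) (snd p) \<in> carrier P"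
    using b by (auto intro: bilinear_maps_closed)
  show ?thesis
    by (rule linear_mapsI)
      (auto simp: tensor_carrier tensor_add tensor_smult tensor_lift_cls[OF P b]
        free_lift_closed[OF P] free_lift_add[OF P] free_lift_smult[OF P] b')
qed

lemma tensor_lift_pure:
  assumes P: "module K P" and b: "\<beta> \<in> bilinear_maps K M N P" and "x \<in> carrier M" "y \<in> carrier N"
  shows "tensor_lift K P \<beta> (pure_tensor K M N x y) = \<beta> x y"
  using free_lift_gen[OF P, of "(x, y)" "carrier M \<times> carrier N" "\<lambda>p. \<beta> (fst p) (snd p)"]
    assms gen_closed by (auto simp: pure_tensor_cls tensor_lift_cls bilinear_maps_closed)

text \<open>Scalars need no case of their own: \<open>c (x \<otimes> y)\<close> is again the pure tensor \<open>(c x) \<otimes> y\<close>.\<close>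

lemma tensor_induct [consumes 1, case_names zero step]:
  assumes "t \<in> carrier T" and "Q \<zero>\<^bsub>T\<^esub>"
    and "\<And>x y s. \<lbrakk>x \<in> carrier M; y \<in> carrier N; s \<in> carrier T; Q s\<rbrakk>
      \<Longrightarrow> Q (pure_tensor K M N x y \<oplus>\<^bsub>T\<^esub> s)"
  shows "Q t"
proof -
  have "Q (cls f)" if "f \<in> carrier F" for f
  proof (rule free_module_induct[OF M.R.is_cring that])
    show "Q (cls \<zero>\<^bsub>F\<^esub>)" using assms(2) by (simp add: tensor_zero)
    fix c p h
    assume *: "c \<in> carrier K" "p \<in> carrier M \<times> carrier N" "h \<in> carrier F" "Q (cls h)"
    then obtain x y where p: "p = (x, y)" "x \<in> carrier M" "y \<in> carrier N" by auto
    have "cls (c \<odot>\<^bsub>F\<^esub> free_gen K p \<oplus>\<^bsub>F\<^esub> h) = pure_tensor K M N (c \<odot>\<^bsub>M\<^esub> x) y \<oplus>\<^bsub>T\<^esub> cls h"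
      using * p linear_mapsD(3)[OF bilinear_mapsD(2)[OF pure_tensor_bilinear p(3)] *(1) p(2)]
      by (simp add: pure_tensor_cls tensor_add[symmetric] tensor_smult[symmetric] gen_closed)
    then show "Q (cls (c \<odot>\<^bsub>F\<^esub> free_gen K p \<oplus>\<^bsub>F\<^esub> h))"
      using assms(3)[of "c \<odot>\<^bsub>M\<^esub> x" y "cls h"] * p by (auto simp: tensor_carrier)
  qed
  then show ?thesis using assms(1) by (auto simp: tensor_carrier)
qed

text \<open>The multiplication of a tensor algebra and the associativity isomorphism are lifts nested in one another. For
  the outer lift to make sense, the inner one has to be linear in its parameter; this holds by induction on the
  tensor to which it is applied.\<close>

lemma tensor_lift_bilinear:
  assumes P: "module K P" and L: "module K L"
    and b: "\<And>z. z \<in> carrier L \<Longrightarrow> \<beta> z \<in> bilinear_maps K M N P"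
    and lin: "\<And>x y. \<lbrakk>x \<in> carrier M; y \<in> carrier N\<rbrakk> \<Longrightarrow> (\<lambda>z. \<beta> z x y) \<in> linear_maps K L P"
  shows "(\<lambda>z. tensor_lift K P (\<beta> z)) \<in> bilinear_maps K L T P"
proof (rule bilinear_mapsI)
  interpret P: module K P by fact
  interpret L: module K L by fact
  show "tensor_lift K P (\<beta> z) \<in> linear_maps K T P" if "z \<in> carrier L" for z
    by (rule tensor_lift_linear[OF P b[OF that]])
  note lift = linear_mapsD[OF tensor_lift_linear[OF P b]]
    linear_map_zero[OF T.module_axioms P tensor_lift_linear[OF P b]] 
    tensor_lift_pure[OF P b]
  fix t assume "t \<in> carrier T"
  then show "(\<lambda>z. tensor_lift K P (\<beta> z) t) \<in> linear_maps K L P"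
  proof (induction rule: tensor_induct)
    case zero
    show ?case by (rule linear_mapsI) (auto simp: lift)
  next
    case (step x y s)
    have "tensor_lift K P (\<beta> z) (pure_tensor K M N x y \<oplus>\<^bsub>T\<^esub> s) = \<beta> z x y \<oplus>\<^bsub>P\<^esub> tensor_lift K P (\<beta> z) s"
      if "z \<in> carrier L" for z
      using step(1-3) that by (simp add: lift pure_tensor_closed)
    then show ?case
      using linear_mapsD[OF lin[OF step(1,2)]] linear_mapsD[OF step(4)]
      by (intro linear_mapsI) (simp_all add: P.M.a_ac P.smult_r_distr)
  qed
qed

end

lemma bilinear_maps_comp:
  assumes "f \<in> linear_maps K L M" "h \<in> linear_maps K L' N" "\<beta> \<in> bilinear_maps K M N P"
  shows "(\<lambda>x y. \<beta> (f x) (h y)) \<in> bilinear_maps K L L' P"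
  using assms by (auto simp: bilinear_maps_def linear_maps_def Pi_iff)

lemma bilinear_maps_swap:
  "\<beta> \<in> bilinear_maps K N M P \<Longrightarrow> (\<lambda>x y. \<beta> y x) \<in> bilinear_maps K M N P"
  by (simp add: bilinear_maps_def)

section \<open>Maps between tensor products\<close>

context tensor_pair
begin

text \<open>Linear maps out of a tensor product are compared on pure tensors only.\<close>

lemma tensor_linear_eqI:
  assumes P: "module K P" and f: "f \<in> linear_maps K T P" and h: "h \<in> linear_maps K T P"
    and eq: "\<And>x y. \<lbrakk>x \<in> carrier M; y \<in> carrier N\<rbrakk> \<Longrightarrow> f (pure_tensor K M N x y) = h (pure_tensor K M N x y)"
    and "t \<in> carrier T"
  shows "f t = h t"
  using assms(5)
  by (induction rule: tensor_induct)
    (simp_all add: linear_map_zero[OF tensor_module_module P f] linear_map_zero[OF tensor_module_module P h]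
      linear_mapsD[OF f] linear_mapsD[OF h] pure_tensor_closed eq)

lemma pure_tensor_add_left:
  "\<lbrakk>x \<in> carrier M; x' \<in> carrier M; y \<in> carrier N\<rbrakk> \<Longrightarrow>
    pure_tensor K M N (x \<oplus>\<^bsub>M\<^esub> x') y = pure_tensor K M N x y \<oplus>\<^bsub>T\<^esub> pure_tensor K M N x' y"
  using pure_tensor_bilinear by (simp add: bilinear_maps_def linear_maps_def)

lemma pure_tensor_add_right:
  "\<lbrakk>x \<in> carrier M; y \<in> carrier N; y' \<in> carrier N\<rbrakk> \<Longrightarrow>
    pure_tensor K M N x (y \<oplus>\<^bsub>N\<^esub> y') = pure_tensor K M N x y \<oplus>\<^bsub>T\<^esub> pure_tensor K M N x y'"
  using pure_tensor_bilinear by (simp add: bilinear_maps_def linear_maps_def)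

lemma pure_tensor_smult_left:
  "\<lbrakk>c \<in> carrier K; x \<in> carrier M; y \<in> carrier N\<rbrakk> \<Longrightarrow>
    pure_tensor K M N (c \<odot>\<^bsub>M\<^esub> x) y = c \<odot>\<^bsub>T\<^esub> pure_tensor K M N x y"
  using pure_tensor_bilinear by (simp add: bilinear_maps_def linear_maps_def)

lemma pure_tensor_linear_left:
  "y \<in> carrier N \<Longrightarrow> (\<lambda>x. pure_tensor K M N x y) \<in> linear_maps K M T"
  using pure_tensor_bilinear by (simp add: bilinear_maps_def)

lemma pure_tensor_linear_right:
  "x \<in> carrier M \<Longrightarrow> pure_tensor K M N x \<in> linear_maps K N T"
  using pure_tensor_bilinear by (simp add: bilinear_maps_def)

lemma pure_tensor_zero_left: "y \<in> carrier N \<Longrightarrow> pure_tensor K M N \<zero>\<^bsub>M\<^esub> y = \<zero>\<^bsub>T\<^esub>"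
  using linear_map_zero[OF M.module_axioms tensor_module_module pure_tensor_linear_left] .

lemma pure_tensor_zero_right: "x \<in> carrier M \<Longrightarrow> pure_tensor K M N x \<zero>\<^bsub>N\<^esub> = \<zero>\<^bsub>T\<^esub>"
  using linear_map_zero[OF N.module_axioms tensor_module_module pure_tensor_linear_right] .

lemma pure_tensor_neg_left:
  "\<lbrakk>x \<in> carrier M; y \<in> carrier N\<rbrakk> \<Longrightarrow>
    pure_tensor K M N (\<ominus>\<^bsub>M\<^esub> x) y = \<ominus>\<^bsub>T\<^esub> pure_tensor K M N x y"
  using linear_map_neg[OF M.module_axioms tensor_module_module pure_tensor_linear_left] .

lemma pure_tensor_neg_right:
  "\<lbrakk>x \<in> carrier M; y \<in> carrier N\<rbrakk> \<Longrightarrow>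
    pure_tensor K M N x (\<ominus>\<^bsub>N\<^esub> y) = \<ominus>\<^bsub>T\<^esub> pure_tensor K M N x y"
  using linear_map_neg[OF N.module_axioms tensor_module_module pure_tensor_linear_right] .

context
  fixes L L' f h
  assumes L: "module K L" and L': "module K L'"
    and f: "f \<in> linear_maps K L M" and h: "h \<in> linear_maps K L' N"
begin

lemma tensor_map_linear: "tensor_map K M N f h \<in> linear_maps K (tensor_module K L L') T"
proof -
  interpret L: tensor_pair K L L' by (intro tensor_pair.intro L L')
  show ?thesis unfolding tensor_map_def
    by (intro L.tensor_lift_linear tensor_module_module bilinear_maps_comp[OF f h pure_tensor_bilinear])
qed

lemma tensor_map_pure:
  "\<lbrakk>x \<in> carrier L; y \<in> carrier L'\<rbrakk> \<Longrightarrow>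
    tensor_map K M N f h (pure_tensor K L L' x y) = pure_tensor K M N (f x) (h y)"
proof -
  interpret L: tensor_pair K L L' by (intro tensor_pair.intro L L')
  show "\<lbrakk>x \<in> carrier L; y \<in> carrier L'\<rbrakk> \<Longrightarrow> ?thesis" unfolding tensor_map_def
    by (intro L.tensor_lift_pure tensor_module_module bilinear_maps_comp[OF f h pure_tensor_bilinear])
qed

end

end

locale tensor_triple = LM: tensor_pair K L M + MN: tensor_pair K M N
  for K :: "('k, 'm) ring_scheme" and L :: "('k, 'a, 'p) module_scheme"
    and M :: "('k, 'b, 'q) module_scheme" and N :: "('k, 'c, 'r) module_scheme"
begin

sublocale LM_N: tensor_pair K "tensor_module K L M" N
  by (intro tensor_pair.intro LM.tensor_module_module MN.N.module_axioms)

sublocale L_MN: tensor_pair K L "tensor_module K M N"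
  by (intro tensor_pair.intro LM.M.module_axioms MN.tensor_module_module)

abbreviation (input) "assoc_inner z x y \<equiv>
  pure_tensor K L (tensor_module K M N) x (pure_tensor K M N y z)"

lemma assoc_inner_bilinear:
  assumes z: "z \<in> carrier N"
  shows "assoc_inner z \<in> bilinear_maps K L M (tensor_module K L (tensor_module K M N))"
  using bilinear_maps_comp[OF linear_maps_id MN.pure_tensor_linear_left[OF z] L_MN.pure_tensor_bilinear] .

lemma assoc_outer_bilinear:
  "(\<lambda>z. tensor_lift K (tensor_module K L (tensor_module K M N)) (assoc_inner z))
    \<in> bilinear_maps K N (tensor_module K L M) (tensor_module K L (tensor_module K M N))"
  by (rule LM.tensor_lift_bilinear[OF L_MN.tensor_module_module MN.N.module_axioms assoc_inner_bilinear])
    (auto intro: linear_maps_comp[OF MN.pure_tensor_linear_right L_MN.pure_tensor_linear_right])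

lemma tensor_assoc_linear:
  "tensor_assoc K L M N \<in> linear_maps K (tensor_module K (tensor_module K L M) N)
    (tensor_module K L (tensor_module K M N))"
  unfolding tensor_assoc_def Let_def
  by (intro LM_N.tensor_lift_linear L_MN.tensor_module_module bilinear_maps_swap[OF assoc_outer_bilinear])

lemma tensor_assoc_pure:
  assumes "x \<in> carrier L" "y \<in> carrier M" "z \<in> carrier N"
  shows "tensor_assoc K L M N (pure_tensor K (tensor_module K L M) N (pure_tensor K L M x y) z) =
    pure_tensor K L (tensor_module K M N) x (pure_tensor K M N y z)"
  unfolding tensor_assoc_def Let_def
  using LM_N.tensor_lift_pure[OF L_MN.tensor_module_module bilinear_maps_swap[OF assoc_outer_bilinear]]
    LM.tensor_lift_pure[OF L_MN.tensor_module_module assoc_inner_bilinear] assms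
  by (simp add: LM.pure_tensor_closed)

end

section \<open>Tensor products of algebras\<close>

lemma tensor_algebra_sel:
  "carrier (tensor_algebra K A B) = carrier (tensor_module K A B)"
  "ring.zero (tensor_algebra K A B) = ring.zero (tensor_module K A B)"
  "ring.add (tensor_algebra K A B) = ring.add (tensor_module K A B)"
  "smult (tensor_algebra K A B) = smult (tensor_module K A B)"
  "\<one>\<^bsub>tensor_algebra K A B\<^esub> = pure_tensor K A B \<one>\<^bsub>A\<^esub> \<one>\<^bsub>B\<^esub>"
  by (simp_all add: tensor_algebra_def Let_def)

lemma linear_maps_tensor_algebra:
  "linear_maps K M (tensor_algebra K A B) = linear_maps K M (tensor_module K A B)"
  by (simp add: linear_maps_def tensor_algebra_sel)

lemma assoc_algebra_mult_bilinear:
  assumes "assoc_algebra K A"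
  shows "monoid.mult A \<in> bilinear_maps K A A A"
proof -
  interpret assoc_algebra K A by fact
  show ?thesis
    by (intro bilinear_mapsI linear_mapsI) (auto simp: l_distr r_distr smult_mult_left smult_mult_right)
qed

locale tensor_algebras = A: assoc_algebra K A + B: assoc_algebra K B
  for K :: "('k, 'm) ring_scheme" and A :: "('k, 'a, 'p) module_scheme"
    and B :: "('k, 'b, 'q) module_scheme"
begin

sublocale tensor_pair K A B
  by (intro tensor_pair.intro A.module_axioms B.module_axioms)

lemma mult_inner_bilinear:
  assumes "x \<in> carrier A" "y \<in> carrier B"
  shows "(\<lambda>x' y'. pure_tensor K A B (x \<otimes>\<^bsub>A\<^esub> x') (y \<otimes>\<^bsub>B\<^esub> y')) \<in> bilinear_maps K A B T"
  using bilinear_maps_comp[OF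
      bilinear_mapsD(1)[OF assoc_algebra_mult_bilinear[OF A.assoc_algebra_axioms] assms(1)]
      bilinear_mapsD(1)[OF assoc_algebra_mult_bilinear[OF B.assoc_algebra_axioms] assms(2)]
      pure_tensor_bilinear] .

text \<open>Exchanging the roles of the factors gives the linear dependence on the parameters \<open>x\<close> and \<open>y\<close> of the
  preceding map that the outer lift requires.\<close>

lemma mult_inner_bilinear':
  assumes "x \<in> carrier A" "y \<in> carrier B"
  shows "(\<lambda>x' y'. pure_tensor K A B (x' \<otimes>\<^bsub>A\<^esub> x) (y' \<otimes>\<^bsub>B\<^esub> y)) \<in> bilinear_maps K A B T"
  using bilinear_maps_comp[OF
      bilinear_mapsD(2)[OF assoc_algebra_mult_bilinear[OF A.assoc_algebra_axioms] assms(1)]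
      bilinear_mapsD(2)[OF assoc_algebra_mult_bilinear[OF B.assoc_algebra_axioms] assms(2)]
      pure_tensor_bilinear] .

text \<open>Linearity in \<open>x\<close> and in \<open>y\<close> are two instances of \<open>tensor_lift_bilinear\<close>, with the other variable fixed.\<close>

lemma mult_outer_bilinear:
  assumes t: "t \<in> carrier T"
  shows "(\<lambda>x y. tensor_lift K T
    (\<lambda>x' y'. pure_tensor K A B (x \<otimes>\<^bsub>A\<^esub> x') (y \<otimes>\<^bsub>B\<^esub> y')) t) \<in> bilinear_maps K A B T"
proof (rule bilinear_mapsI)
  fix x assume x: "x \<in> carrier A"
  have "(\<lambda>y. tensor_lift K T (\<lambda>x' y'. pure_tensor K A B (x \<otimes>\<^bsub>A\<^esub> x') (y \<otimes>\<^bsub>B\<^esub> y')))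
    \<in> bilinear_maps K B T T"
    by (rule tensor_lift_bilinear[OF tensor_module_module B.module_axioms mult_inner_bilinear[OF x]])
      (auto intro: bilinear_mapsD(1)[OF mult_inner_bilinear'] x)
  then show "(\<lambda>y. tensor_lift K T (\<lambda>x' y'. pure_tensor K A B (x \<otimes>\<^bsub>A\<^esub> x') (y \<otimes>\<^bsub>B\<^esub> y')) t)
    \<in> linear_maps K B T"
    by (rule bilinear_mapsD(2)) fact
next
  fix y assume y: "y \<in> carrier B"
  have "(\<lambda>x. tensor_lift K T (\<lambda>x' y'. pure_tensor K A B (x \<otimes>\<^bsub>A\<^esub> x') (y \<otimes>\<^bsub>B\<^esub> y')))
    \<in> bilinear_maps K A T T"
    by (rule tensor_lift_bilinear[OF tensor_module_module A.module_axioms mult_inner_bilinear[OF _ y]])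
      (auto intro: bilinear_mapsD(2)[OF mult_inner_bilinear'] y)
  then show "(\<lambda>x. tensor_lift K T (\<lambda>x' y'. pure_tensor K A B (x \<otimes>\<^bsub>A\<^esub> x') (y \<otimes>\<^bsub>B\<^esub> y')) t)
    \<in> linear_maps K A T"
    by (rule bilinear_mapsD(2)) fact
qed

lemma tensor_mult_bilinear:
  "monoid.mult (tensor_algebra K A B) \<in> bilinear_maps K T T T"
proof -
  have inner: "tensor_lift K T (\<lambda>x' y'. pure_tensor K A B (x \<otimes>\<^bsub>A\<^esub> x') (y \<otimes>\<^bsub>B\<^esub> y')) \<in> linear_maps K T T"
    if "x \<in> carrier A" "y \<in> carrier B" for x y
    by (rule tensor_lift_linear[OF tensor_module_module mult_inner_bilinear[OF that]])
  show ?thesis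
    using bilinear_maps_swap[OF tensor_lift_bilinear[OF tensor_module_module tensor_module_module
          mult_outer_bilinear inner]]
    by (simp add: tensor_algebra_def Let_def)
qed

lemma tensor_mult_pure:
  assumes "x \<in> carrier A" "y \<in> carrier B" "x' \<in> carrier A" "y' \<in> carrier B"
  shows "pure_tensor K A B x y \<otimes>\<^bsub>tensor_algebra K A B\<^esub> pure_tensor K A B x' y' =
    pure_tensor K A B (x \<otimes>\<^bsub>A\<^esub> x') (y \<otimes>\<^bsub>B\<^esub> y')"
  using tensor_lift_pure[OF tensor_module_module mult_outer_bilinear assms(1,2)]
    tensor_lift_pure[OF tensor_module_module mult_inner_bilinear assms(3,4)] assms
  by (simp add: tensor_algebra_def Let_def pure_tensor_closed)

lemma tensor_mult_distrib:
  assumes "s \<in> carrier T" "t \<in> carrier T" "u \<in> carrier T"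
  shows "(s \<oplus>\<^bsub>T\<^esub> t) \<otimes>\<^bsub>tensor_algebra K A B\<^esub> u =
      s \<otimes>\<^bsub>tensor_algebra K A B\<^esub> u \<oplus>\<^bsub>T\<^esub> t \<otimes>\<^bsub>tensor_algebra K A B\<^esub> u"
    and "s \<otimes>\<^bsub>tensor_algebra K A B\<^esub> (t \<oplus>\<^bsub>T\<^esub> u) =
      s \<otimes>\<^bsub>tensor_algebra K A B\<^esub> t \<oplus>\<^bsub>T\<^esub> s \<otimes>\<^bsub>tensor_algebra K A B\<^esub> u"
  using tensor_mult_bilinear assms by (simp_all add: bilinear_maps_def linear_maps_def)

end

section \<open>Sweedler's Hopf algebra\<close>

text \<open>The element \<open>a + b g + c y + d g y\<close> is encoded as \<open>mk a b c d\<close> by an arbitrary injective \<open>mk\<close>. This places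
  the algebra directly into any type that is large enough and avoids transporting a Hopf algebra along a
  bijection. The structure below is written in the coordinates of this encoding.\<close>

definition sweedler_coords ::
  "[('k, 'm) ring_scheme, 'k \<Rightarrow> 'k \<Rightarrow> 'k \<Rightarrow> 'k \<Rightarrow> 'u, 'u] \<Rightarrow> 'k \<times> 'k \<times> 'k \<times> 'k"
  where "sweedler_coords K mk u = (THE p. \<exists>a\<in>carrier K. \<exists>b\<in>carrier K. \<exists>c\<in>carrier K. \<exists>d\<in>carrier K.
    u = mk a b c d \<and> p = (a, b, c, d))"

text \<open>The product is the one forced by \<open>g\<^sup>2 = 1\<close>, \<open>y\<^sup>2 = 0\<close> and \<open>y g = - g y\<close>.\<close>

definition sweedler_algebra ::
  "[('k, 'm) ring_scheme, 'k \<Rightarrow> 'k \<Rightarrow> 'k \<Rightarrow> 'k \<Rightarrow> 'u] \<Rightarrow> ('k, 'u) module"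
  where "sweedler_algebra K mk =
    \<lparr>carrier = {mk a b c d | a b c d.
        a \<in> carrier K \<and> b \<in> carrier K \<and> c \<in> carrier K \<and> d \<in> carrier K},
     monoid.mult = (\<lambda>u v. case sweedler_coords K mk u of (a, b, c, d) \<Rightarrow>
       case sweedler_coords K mk v of (a', b', c', d') \<Rightarrow>
       mk (a \<otimes>\<^bsub>K\<^esub> a' \<oplus>\<^bsub>K\<^esub> b \<otimes>\<^bsub>K\<^esub> b')
          (a \<otimes>\<^bsub>K\<^esub> b' \<oplus>\<^bsub>K\<^esub> b \<otimes>\<^bsub>K\<^esub> a')
          (a \<otimes>\<^bsub>K\<^esub> c' \<oplus>\<^bsub>K\<^esub> b \<otimes>\<^bsub>K\<^esub> d' \<oplus>\<^bsub>K\<^esub> c \<otimes>\<^bsub>K\<^esub> a' \<ominus>\<^bsub>K\<^esub> d \<otimes>\<^bsub>K\<^esub> b')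
          (a \<otimes>\<^bsub>K\<^esub> d' \<oplus>\<^bsub>K\<^esub> b \<otimes>\<^bsub>K\<^esub> c' \<oplus>\<^bsub>K\<^esub> d \<otimes>\<^bsub>K\<^esub> a' \<ominus>\<^bsub>K\<^esub> c \<otimes>\<^bsub>K\<^esub> b')),
     one = mk \<one>\<^bsub>K\<^esub> \<zero>\<^bsub>K\<^esub> \<zero>\<^bsub>K\<^esub> \<zero>\<^bsub>K\<^esub>,
     ring.zero = mk \<zero>\<^bsub>K\<^esub> \<zero>\<^bsub>K\<^esub> \<zero>\<^bsub>K\<^esub> \<zero>\<^bsub>K\<^esub>,
     ring.add = (\<lambda>u v. case sweedler_coords K mk u of (a, b, c, d) \<Rightarrow>
       case sweedler_coords K mk v of (a', b', c', d') \<Rightarrow>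
       mk (a \<oplus>\<^bsub>K\<^esub> a') (b \<oplus>\<^bsub>K\<^esub> b') (c \<oplus>\<^bsub>K\<^esub> c') (d \<oplus>\<^bsub>K\<^esub> d')),
     smult = (\<lambda>k u. case sweedler_coords K mk u of (a, b, c, d) \<Rightarrow>
       mk (k \<otimes>\<^bsub>K\<^esub> a) (k \<otimes>\<^bsub>K\<^esub> b) (k \<otimes>\<^bsub>K\<^esub> c) (k \<otimes>\<^bsub>K\<^esub> d))\<rparr>"

text \<open>The linear extension of a map on the basis, with \<open>p, q, r, s\<close> the images of \<open>1, g, y, g y\<close>.\<close>

definition sweedler_ext ::
  "[('k, 'm) ring_scheme, 'k \<Rightarrow> 'k \<Rightarrow> 'k \<Rightarrow> 'k \<Rightarrow> 'u, ('k, 'c, 'r) module_scheme, 'c, 'c, 'c, 'c, 'u] \<Rightarrow> 'c"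
  where "sweedler_ext K mk P p q r s u = (case sweedler_coords K mk u of (a, b, c, d) \<Rightarrow>
    a \<odot>\<^bsub>P\<^esub> p \<oplus>\<^bsub>P\<^esub> b \<odot>\<^bsub>P\<^esub> q \<oplus>\<^bsub>P\<^esub> c \<odot>\<^bsub>P\<^esub> r \<oplus>\<^bsub>P\<^esub> d \<odot>\<^bsub>P\<^esub> s)"

text \<open>On \<open>z = g y\<close> the values are dictated by multiplicativity:
  \<open>\<Delta>(z) = \<Delta>(g) \<Delta>(y) = z \<otimes> 1 + g \<otimes> z\<close> since \<open>g\<^sup>2 = 1\<close>, and \<open>S(z) = S(y) S(g) = z g = - y\<close>. The value
  \<open>S(y) = z\<close> solves \<open>S(y) g + y = 0\<close>, the antipode axiom at \<open>y\<close>.\<close>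

definition sweedler_hopf ::
  "[('k, 'm) ring_scheme, 'k \<Rightarrow> 'k \<Rightarrow> 'k \<Rightarrow> 'k \<Rightarrow> 'u] \<Rightarrow> ('k, 'u) hopf"
  where "sweedler_hopf K mk =
    (let H = sweedler_algebra K mk; T = tensor_module K H H; t = pure_tensor K H H;
         e = \<one>\<^bsub>H\<^esub>;
         g = mk \<zero>\<^bsub>K\<^esub> \<one>\<^bsub>K\<^esub> \<zero>\<^bsub>K\<^esub> \<zero>\<^bsub>K\<^esub>;
         y = mk \<zero>\<^bsub>K\<^esub> \<zero>\<^bsub>K\<^esub> \<one>\<^bsub>K\<^esub> \<zero>\<^bsub>K\<^esub>;
         z = mk \<zero>\<^bsub>K\<^esub> \<zero>\<^bsub>K\<^esub> \<zero>\<^bsub>K\<^esub> \<one>\<^bsub>K\<^esub>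
     in module.extend H
       \<lparr>comult = sweedler_ext K mk T (t e e) (t g g) (t y g \<oplus>\<^bsub>T\<^esub> t e y) (t z e \<oplus>\<^bsub>T\<^esub> t g z),
        counit = sweedler_ext K mk (self_algebra K) \<one>\<^bsub>K\<^esub> \<one>\<^bsub>K\<^esub> \<zero>\<^bsub>K\<^esub> \<zero>\<^bsub>K\<^esub>,
        antipode = sweedler_ext K mk H e g z (\<ominus>\<^bsub>H\<^esub> y)\<rparr>)"

lemma self_algebra_sel:
  "carrier (self_algebra K) = carrier K" "monoid.mult (self_algebra K) = monoid.mult K"
  "\<one>\<^bsub>self_algebra K\<^esub> = \<one>\<^bsub>K\<^esub>" "\<zero>\<^bsub>self_algebra K\<^esub> = \<zero>\<^bsub>K\<^esub>"
  "ring.add (self_algebra K) = ring.add K" "smult (self_algebra K) = monoid.mult K"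
  by (simp_all add: self_algebra_def)

lemma self_algebra_module:
  assumes "cring K"
  shows "module K (self_algebra K)"
proof -
  interpret cring K by fact
  have "abelian_group (self_algebra K)"
    by (rule abelian_groupI) (auto simp: self_algebra_sel a_ac intro: l_neg)
  then show ?thesis
    by (intro moduleI assms) (auto simp: self_algebra_sel l_distr r_distr m_assoc)
qed

locale sweedler = field K
  for K :: "('k, 'm) ring_scheme" (structure) +
  fixes mk :: "'k \<Rightarrow> 'k \<Rightarrow> 'k \<Rightarrow> 'k \<Rightarrow> 'u"
  assumes mk_inject: "\<lbrakk>a \<in> carrier K; b \<in> carrier K; c \<in> carrier K; d \<in> carrier K;
    a' \<in> carrier K; b' \<in> carrier K; c' \<in> carrier K; d' \<in> carrier K; mk a b c d = mk a' b' c' d'\<rbrakk>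
    \<Longrightarrow> a = a' \<and> b = b' \<and> c = c' \<and> d = d'"
begin

abbreviation "H \<equiv> sweedler_hopf K mk"
abbreviation "HH \<equiv> tensor_module K H H"
abbreviation "g \<equiv> mk \<zero> \<one> \<zero> \<zero>"
abbreviation "y \<equiv> mk \<zero> \<zero> \<one> \<zero>"
abbreviation "z \<equiv> mk \<zero> \<zero> \<zero> \<one>"

lemma coords_mk:
  assumes "a \<in> carrier K" "b \<in> carrier K" "c \<in> carrier K" "d \<in> carrier K"
  shows "sweedler_coords K mk (mk a b c d) = (a, b, c, d)"
  unfolding sweedler_coords_def by (rule the_equality) (use assms in \<open>auto dest!: mk_inject[rotated -1]\<close>)

lemma algebra_sel:
  "carrier H = carrier (sweedler_algebra K mk)" "monoid.mult H = monoid.mult (sweedler_algebra K mk)"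
  "one H = one (sweedler_algebra K mk)" "ring.zero H = ring.zero (sweedler_algebra K mk)"
  "ring.add H = ring.add (sweedler_algebra K mk)" "smult H = smult (sweedler_algebra K mk)"
  by (simp_all add: sweedler_hopf_def Let_def module.defs sweedler_algebra_def)

text \<open>The comultiplication is defined with tensors over the bare algebra, whereas the axioms speak of tensors over
  the Hopf algebra; both records have the same module structure, and this is all that enters a tensor product.\<close>

lemma tensor_sel:
  "tensor_module K (sweedler_algebra K mk) (sweedler_algebra K mk) = HH"
  "pure_tensor K (sweedler_algebra K mk) (sweedler_algebra K mk) = pure_tensor K H H"
  by (simp_all add: fun_eq_iff tensor_module_def pure_tensor_def tensor_kernel_def bilinear_relations_def algebra_sel)

lemma H_carrier: "carrier H = {mk a b c d | a b c d.
        a \<in> carrier K \<and> b \<in> carrier K \<and> c \<in> carrier K \<and> d \<in> carrier K}"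
  by (simp add: algebra_sel sweedler_algebra_def)

lemma mk_closed:
  "\<lbrakk>a \<in> carrier K; b \<in> carrier K; c \<in> carrier K; d \<in> carrier K\<rbrakk> \<Longrightarrow> mk a b c d \<in> carrier H"
  by (auto simp: H_carrier)

lemma H_cases:
  assumes "u \<in> carrier H"
  obtains a b c d where "a \<in> carrier K" "b \<in> carrier K" "c \<in> carrier K" "d \<in> carrier K" "u = mk a b c d"
  using assms by (auto simp: H_carrier)

lemma mk_add: "\<lbrakk>a \<in> carrier K; b \<in> carrier K; c \<in> carrier K; d \<in> carrier K;
    a' \<in> carrier K; b' \<in> carrier K; c' \<in> carrier K; d' \<in> carrier K\<rbrakk> \<Longrightarrow>
    mk a b c d \<oplus>\<^bsub>H\<^esub> mk a' b' c' d' = mk (a \<oplus> a') (b \<oplus> b') (c \<oplus> c') (d \<oplus> d')"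
  by (simp add: algebra_sel) (simp add: sweedler_algebra_def coords_mk)

lemma mk_smult: "\<lbrakk>k \<in> carrier K; a \<in> carrier K; b \<in> carrier K; c \<in> carrier K; d \<in> carrier K\<rbrakk> \<Longrightarrow>
    k \<odot>\<^bsub>H\<^esub> mk a b c d = mk (k \<otimes> a) (k \<otimes> b) (k \<otimes> c) (k \<otimes> d)"
  by (simp add: algebra_sel) (simp add: sweedler_algebra_def coords_mk)

lemma mk_mult: "\<lbrakk>a \<in> carrier K; b \<in> carrier K; c \<in> carrier K; d \<in> carrier K;
    a' \<in> carrier K; b' \<in> carrier K; c' \<in> carrier K; d' \<in> carrier K\<rbrakk> \<Longrightarrow>
    mk a b c d \<otimes>\<^bsub>H\<^esub> mk a' b' c' d' =
      mk (a \<otimes> a' \<oplus> b \<otimes> b') (a \<otimes> b' \<oplus> b \<otimes> a')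
         (a \<otimes> c' \<oplus> b \<otimes> d' \<oplus> c \<otimes> a' \<ominus> d \<otimes> b') (a \<otimes> d' \<oplus> b \<otimes> c' \<oplus> d \<otimes> a' \<ominus> c \<otimes> b')"
  by (simp add: algebra_sel) (simp add: sweedler_algebra_def coords_mk)

lemma mk_zero: "\<zero>\<^bsub>H\<^esub> = mk \<zero> \<zero> \<zero> \<zero>" and mk_one: "\<one>\<^bsub>H\<^esub> = mk \<one> \<zero> \<zero> \<zero>"
  by (simp_all add: algebra_sel) (simp_all add: sweedler_algebra_def)

lemma H_module: "module K H"
proof -
  have "abelian_group H"
  proof (rule abelian_groupI)
    fix u assume "u \<in> carrier H"
    then obtain a b c d where u: "a \<in> carrier K" "b \<in> carrier K" "c \<in> carrier K" "d \<in> carrier K"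
      "u = mk a b c d" by (rule H_cases)
    show "\<exists>v\<in>carrier H. v \<oplus>\<^bsub>H\<^esub> u = \<zero>\<^bsub>H\<^esub>"
      by (rule bexI[of _ "mk (\<ominus> a) (\<ominus> b) (\<ominus> c) (\<ominus> d)"]) (use u in \<open>simp_all add: mk_add mk_zero mk_closed l_neg\<close>)
  qed (auto elim!: H_cases simp: mk_closed mk_add mk_zero a_ac)
  then show ?thesis
    by (intro moduleI is_cring) (auto elim!: H_cases simp: mk_closed mk_add mk_smult l_distr r_distr m_assoc)
qed

lemma mk_minus: "\<lbrakk>a \<in> carrier K; b \<in> carrier K; c \<in> carrier K; d \<in> carrier K\<rbrakk> \<Longrightarrow>
    \<ominus>\<^bsub>H\<^esub> mk a b c d = mk (\<ominus> a) (\<ominus> b) (\<ominus> c) (\<ominus> d)"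
proof -
  interpret H: module K H by (rule H_module)
  show "\<lbrakk>a \<in> carrier K; b \<in> carrier K; c \<in> carrier K; d \<in> carrier K\<rbrakk> \<Longrightarrow> ?thesis"
    by (rule H.M.minus_equality) (simp_all add: mk_add mk_zero mk_closed l_neg)
qed

text \<open>In coordinates both sides expand to the same signed monomials, so no cancellation is needed.\<close>

lemma H_assoc:
  assumes "u \<in> carrier H" "v \<in> carrier H" "w \<in> carrier H"
  shows "(u \<otimes>\<^bsub>H\<^esub> v) \<otimes>\<^bsub>H\<^esub> w = u \<otimes>\<^bsub>H\<^esub> (v \<otimes>\<^bsub>H\<^esub> w)"
  using assms
  by (auto elim!: H_cases simp: mk_closed mk_mult minus_eq l_distr r_distr l_minus r_minus minus_add m_assoc a_ac)

lemma H_algebra: "assoc_algebra K H"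
proof -
  have "ring H"
  proof (intro ringI module.axioms(2)[OF H_module] monoidI H_assoc)
    show "\<And>u v w. \<lbrakk>u \<in> carrier H; v \<in> carrier H; w \<in> carrier H\<rbrakk> \<Longrightarrow>
      (u \<oplus>\<^bsub>H\<^esub> v) \<otimes>\<^bsub>H\<^esub> w = u \<otimes>\<^bsub>H\<^esub> w \<oplus>\<^bsub>H\<^esub> v \<otimes>\<^bsub>H\<^esub> w"
      "\<And>u v w. \<lbrakk>u \<in> carrier H; v \<in> carrier H; w \<in> carrier H\<rbrakk> \<Longrightarrow>
      w \<otimes>\<^bsub>H\<^esub> (u \<oplus>\<^bsub>H\<^esub> v) = w \<otimes>\<^bsub>H\<^esub> u \<oplus>\<^bsub>H\<^esub> w \<otimes>\<^bsub>H\<^esub> v"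
      by (auto elim!: H_cases simp: mk_closed mk_mult mk_add minus_eq l_distr r_distr minus_add a_ac)
  qed (auto elim!: H_cases simp: mk_closed mk_mult mk_one minus_eq)
  then show ?thesis
    by (intro assoc_algebra.intro H_module assoc_algebra_axioms.intro)
      (auto elim!: H_cases simp: mk_closed mk_mult mk_smult minus_eq r_distr r_minus m_ac)
qed

sublocale H: assoc_algebra K H by (rule H_algebra)

lemma ext_mk:
  "\<lbrakk>a \<in> carrier K; b \<in> carrier K; c \<in> carrier K; d \<in> carrier K\<rbrakk> \<Longrightarrow>
    sweedler_ext K mk P p q r s (mk a b c d) =
      a \<odot>\<^bsub>P\<^esub> p \<oplus>\<^bsub>P\<^esub> b \<odot>\<^bsub>P\<^esub> q \<oplus>\<^bsub>P\<^esub> c \<odot>\<^bsub>P\<^esub> r \<oplus>\<^bsub>P\<^esub> d \<odot>\<^bsub>P\<^esub> s"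
  by (simp add: sweedler_ext_def coords_mk)

lemma basis_closed: "g \<in> carrier H" "y \<in> carrier H" "z \<in> carrier H"
  by (simp_all add: mk_closed)

lemma basis_mult:
  "g \<otimes>\<^bsub>H\<^esub> g = \<one>\<^bsub>H\<^esub>" "g \<otimes>\<^bsub>H\<^esub> y = z" "g \<otimes>\<^bsub>H\<^esub> z = y"
  "y \<otimes>\<^bsub>H\<^esub> g = \<ominus>\<^bsub>H\<^esub> z" "y \<otimes>\<^bsub>H\<^esub> y = \<zero>\<^bsub>H\<^esub>" "y \<otimes>\<^bsub>H\<^esub> z = \<zero>\<^bsub>H\<^esub>"
  "z \<otimes>\<^bsub>H\<^esub> g = \<ominus>\<^bsub>H\<^esub> y" "z \<otimes>\<^bsub>H\<^esub> y = \<zero>\<^bsub>H\<^esub>" "z \<otimes>\<^bsub>H\<^esub> z = \<zero>\<^bsub>H\<^esub>"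
  by (simp_all add: mk_mult mk_one mk_zero mk_minus minus_eq)

context
  fixes P :: "('k, 'c, 'r) module_scheme"
  assumes P: "module K P"
begin

interpretation P: module K P by (rule P)

lemma ext_linear:
  assumes "p \<in> carrier P" "q \<in> carrier P" "r \<in> carrier P" "s \<in> carrier P"
  shows "sweedler_ext K mk P p q r s \<in> linear_maps K H P"
  by (rule linear_mapsI)
    (use assms in \<open>auto elim!: H_cases simp: mk_closed mk_add mk_smult ext_mk P.smult_l_distr P.smult_r_distr P.smult_assoc1 P.M.a_ac\<close>)

lemma ext_basis:
  assumes "p \<in> carrier P" "q \<in> carrier P" "r \<in> carrier P" "s \<in> carrier P"
  shows "sweedler_ext K mk P p q r s \<one>\<^bsub>H\<^esub> = p" "sweedler_ext K mk P p q r s g = q"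
    "sweedler_ext K mk P p q r s y = r" "sweedler_ext K mk P p q r s z = s"
  using assms by (simp_all add: mk_one ext_mk)

lemma linear_eq_on_basis:
  assumes f: "f \<in> linear_maps K H P" and h: "h \<in> linear_maps K H P"
    and eq: "f \<one>\<^bsub>H\<^esub> = h \<one>\<^bsub>H\<^esub>" "f g = h g" "f y = h y" "f z = h z"
    and "u \<in> carrier H"
  shows "f u = h u"
proof -
  obtain a b c d where u: "a \<in> carrier K" "b \<in> carrier K" "c \<in> carrier K" "d \<in> carrier K"
    "u = mk a b c d" using assms(7) by (rule H_cases)
  have "u = a \<odot>\<^bsub>H\<^esub> \<one>\<^bsub>H\<^esub> \<oplus>\<^bsub>H\<^esub> b \<odot>\<^bsub>H\<^esub> g \<oplus>\<^bsub>H\<^esub> c \<odot>\<^bsub>H\<^esub> y \<oplus>\<^bsub>H\<^esub> d \<odot>\<^bsub>H\<^esub> z"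
    using u by (simp add: mk_one mk_smult mk_add)
  then show ?thesis
    using u(1-4) by (simp add: linear_mapsD[OF f] linear_mapsD[OF h] basis_closed eq)
qed

text \<open>With this, multiplicativity of the comultiplication becomes a check of sixteen products of basis elements.\<close>

lemma bilinear_eq_on_basis:
  assumes \<beta>: "\<beta> \<in> bilinear_maps K H H P" and \<gamma>: "\<gamma> \<in> bilinear_maps K H H P"
    and eq: "\<And>a b. \<lbrakk>a \<in> {\<one>\<^bsub>H\<^esub>, g, y, z}; b \<in> {\<one>\<^bsub>H\<^esub>, g, y, z}\<rbrakk> \<Longrightarrow> \<beta> a b = \<gamma> a b"
    and "u \<in> carrier H" "v \<in> carrier H"
  shows "\<beta> u v = \<gamma> u v"
proof -
  have *: "\<beta> a v = \<gamma> a v" if a: "a \<in> {\<one>\<^bsub>H\<^esub>, g, y, z}" for a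
  proof -
    have "a \<in> carrier H" using a basis_closed H.one_closed by blast
    then show ?thesis
      by (intro linear_eq_on_basis[OF bilinear_mapsD(1)[OF \<beta>] bilinear_mapsD(1)[OF \<gamma>] _ _ _ _ assms(5)]
          eq a; simp)
  qed
  show ?thesis
    by (rule linear_eq_on_basis[OF bilinear_mapsD(2)[OF \<beta>] bilinear_mapsD(2)[OF \<gamma>] _ _ _ _ assms(4)])
      (simp_all add: * assms)
qed

end

end

lemma module_extend_sel:
  "comult (module.extend M \<lparr>comult = a, counit = b, antipode = c\<rparr>) = a"
  "counit (module.extend M \<lparr>comult = a, counit = b, antipode = c\<rparr>) = b"
  "antipode (module.extend M \<lparr>comult = a, counit = b, antipode = c\<rparr>) = c"
  by (simp_all add: module.defs)

context sweedler begin

sublocale HH: tensor_algebras K H H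
  by (intro tensor_algebras.intro H_algebra)

sublocale HHH: tensor_triple K H H H
  by (intro tensor_triple.intro HH.tensor_pair_axioms)

abbreviation "t \<equiv> pure_tensor K H H"

lemma hopf_sel:
  "comult H = sweedler_ext K mk HH (t \<one>\<^bsub>H\<^esub> \<one>\<^bsub>H\<^esub>) (t g g) (t y g \<oplus>\<^bsub>HH\<^esub> t \<one>\<^bsub>H\<^esub> y) (t z \<one>\<^bsub>H\<^esub> \<oplus>\<^bsub>HH\<^esub> t g z)"
  "counit H = sweedler_ext K mk (self_algebra K) \<one> \<one> \<zero> \<zero>"
  "antipode H = sweedler_ext K mk H \<one>\<^bsub>H\<^esub> g z (\<ominus>\<^bsub>H\<^esub> y)"
proof -
  let ?A = "sweedler_algebra K mk"
  have ext: "sweedler_ext K mk ?A = sweedler_ext K mk H" and neg: "\<ominus>\<^bsub>?A\<^esub> y = \<ominus>\<^bsub>H\<^esub> y"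
    by (simp_all add: fun_eq_iff sweedler_ext_def a_inv_def m_inv_def algebra_sel)
  note fold = tensor_sel algebra_sel(3)[symmetric] algebra_sel(5)[symmetric] ext neg
  let ?T = "tensor_module K ?A ?A" and ?t = "pure_tensor K ?A ?A" and ?e = "\<one>\<^bsub>?A\<^esub>"
  have "comult H = sweedler_ext K mk ?T (?t ?e ?e) (?t g g) (?t y g \<oplus>\<^bsub>?T\<^esub> ?t ?e y) (?t z ?e \<oplus>\<^bsub>?T\<^esub> ?t g z)"
    by (simp only: sweedler_hopf_def Let_def module_extend_sel)
  then show "comult H = sweedler_ext K mk HH (t \<one>\<^bsub>H\<^esub> \<one>\<^bsub>H\<^esub>) (t g g) (t y g \<oplus>\<^bsub>HH\<^esub> t \<one>\<^bsub>H\<^esub> y) (t z \<one>\<^bsub>H\<^esub> \<oplus>\<^bsub>HH\<^esub> t g z)"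
    unfolding fold .
  show "counit H = sweedler_ext K mk (self_algebra K) \<one> \<one> \<zero> \<zero>"
    by (simp only: sweedler_hopf_def Let_def module_extend_sel)
  have "antipode H = sweedler_ext K mk ?A ?e g z (\<ominus>\<^bsub>?A\<^esub> y)"
    by (simp only: sweedler_hopf_def Let_def module_extend_sel)
  then show "antipode H = sweedler_ext K mk H \<one>\<^bsub>H\<^esub> g z (\<ominus>\<^bsub>H\<^esub> y)"
    unfolding fold .
qed

lemma t_closed: "\<lbrakk>u \<in> carrier H; v \<in> carrier H\<rbrakk> \<Longrightarrow> t u v \<in> carrier HH"
  by (rule HH.pure_tensor_closed)

lemma comult_linear: "comult H \<in> linear_maps K H HH"
  unfolding hopf_sel
  by (intro ext_linear HH.tensor_module_module HH.T.M.a_closed t_closed basis_closed H.one_closed)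

lemma comult_basis:
  "comult H \<one>\<^bsub>H\<^esub> = t \<one>\<^bsub>H\<^esub> \<one>\<^bsub>H\<^esub>" "comult H g = t g g"
  "comult H y = t y g \<oplus>\<^bsub>HH\<^esub> t \<one>\<^bsub>H\<^esub> y" "comult H z = t z \<one>\<^bsub>H\<^esub> \<oplus>\<^bsub>HH\<^esub> t g z"
  unfolding hopf_sel
  by (intro ext_basis HH.tensor_module_module HH.T.M.a_closed t_closed basis_closed H.one_closed)+

lemma counit_linear: "counit H \<in> linear_maps K H (self_algebra K)"
  unfolding hopf_sel by (intro ext_linear self_algebra_module is_cring) (auto simp: self_algebra_sel)

lemma counit_basis: "counit H \<one>\<^bsub>H\<^esub> = \<one>" "counit H g = \<one>" "counit H y = \<zero>" "counit H z = \<zero>"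
  unfolding hopf_sel by (rule ext_basis[OF self_algebra_module[OF is_cring]]; simp add: self_algebra_sel)+

lemma antipode_linear: "antipode H \<in> linear_maps K H H"
  unfolding hopf_sel by (intro ext_linear H_module H.M.a_inv_closed basis_closed H.one_closed)

lemma antipode_basis:
  "antipode H \<one>\<^bsub>H\<^esub> = \<one>\<^bsub>H\<^esub>" "antipode H g = g" "antipode H y = z" "antipode H z = \<ominus>\<^bsub>H\<^esub> y"
  unfolding hopf_sel by (intro ext_basis H_module H.M.a_inv_closed basis_closed H.one_closed)+

lemma mult_bilinear: "monoid.mult H \<in> bilinear_maps K H H H"
  by (rule assoc_algebra_mult_bilinear[OF H_algebra])

text \<open>Among the sixteen products the ones with content are \<open>\<Delta>(g) \<Delta>(y) = - \<Delta>(y) \<Delta>(g)\<close> and \<open>\<Delta>(y)\<^sup>2 = 0\<close>. In the latter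
  the mixed terms are \<open>y \<otimes> g y\<close> and \<open>y \<otimes> y g\<close>, which cancel because \<open>g\<close> and \<open>y\<close> anticommute.\<close>

lemma comult_hom: "comult H \<in> algebra_hom K H (tensor_algebra K H H)"
proof -
  note lin = linear_mapsD[OF comult_linear] linear_map_zero[OF H_module HH.tensor_module_module comult_linear]
    linear_map_neg[OF H_module HH.tensor_module_module comult_linear]
  have "comult H (u \<otimes>\<^bsub>H\<^esub> v) = comult H u \<otimes>\<^bsub>tensor_algebra K H H\<^esub> comult H v"
    if "u \<in> carrier H" "v \<in> carrier H" for u v
  proof (rule bilinear_eq_on_basis[OF HH.tensor_module_module, where \<beta> = "\<lambda>u v. comult H (u \<otimes>\<^bsub>H\<^esub> v)"
        and \<gamma> = "\<lambda>u v. comult H u \<otimes>\<^bsub>tensor_algebra K H H\<^esub> comult H v"])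
    show "(\<lambda>u v. comult H (u \<otimes>\<^bsub>H\<^esub> v)) \<in> bilinear_maps K H H HH"
      by (intro bilinear_mapsI linear_maps_comp[OF _ comult_linear] bilinear_mapsD[OF mult_bilinear])
    show "(\<lambda>u v. comult H u \<otimes>\<^bsub>tensor_algebra K H H\<^esub> comult H v) \<in> bilinear_maps K H H HH"
      by (rule bilinear_maps_comp[OF comult_linear comult_linear HH.tensor_mult_bilinear])
    fix a b assume "a \<in> {\<one>\<^bsub>H\<^esub>, g, y, z}" "b \<in> {\<one>\<^bsub>H\<^esub>, g, y, z}"
    then show "comult H (a \<otimes>\<^bsub>H\<^esub> b) = comult H a \<otimes>\<^bsub>tensor_algebra K H H\<^esub> comult H b"
      by (elim insertE emptyE; simp add: comult_basis basis_mult lin basis_closed t_closed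
          HH.tensor_mult_distrib HH.tensor_mult_pure HH.pure_tensor_neg_left HH.pure_tensor_neg_right
          HH.pure_tensor_zero_left HH.pure_tensor_zero_right HH.T.M.a_ac HH.T.M.r_neg HH.T.M.l_neg
          HH.T.M.minus_add)
  qed fact+
  then show ?thesis
    by (auto simp: algebra_hom_def linear_maps_tensor_algebra comult_linear ring_hom_def
        tensor_algebra_sel lin comult_basis)
qed

lemma counit_hom: "counit H \<in> algebra_hom K H (self_algebra K)"
proof -
  have "counit H (u \<otimes>\<^bsub>H\<^esub> v) = counit H u \<otimes> counit H v" if "u \<in> carrier H" "v \<in> carrier H" for u v
    using that
    by (auto elim!: H_cases simp: hopf_sel mk_mult ext_mk self_algebra_sel l_distr r_distr a_ac)
  then show ?thesis
    using counit_linear linear_mapsD[OF counit_linear]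
    by (auto simp: algebra_hom_def ring_hom_def self_algebra_sel counit_basis)
qed

lemma coassoc:
  assumes "h \<in> carrier H"
  shows "tensor_assoc K H H H (tensor_map K HH H (comult H) (\<lambda>x. x) (comult H h)) =
    tensor_map K H HH (\<lambda>x. x) (comult H) (comult H h)"
proof -
  note id = linear_maps_id[of K H]
  note L = HHH.LM_N.tensor_map_linear[OF H_module H_module comult_linear id]
  note R = HHH.L_MN.tensor_map_linear[OF H_module H_module id comult_linear]
  note pure = HHH.LM_N.tensor_map_pure[OF H_module H_module comult_linear id]
    HHH.L_MN.tensor_map_pure[OF H_module H_module id comult_linear]
  note add = linear_mapsD(2)[OF L] linear_mapsD(2)[OF R] linear_mapsD(2)[OF HHH.tensor_assoc_linear]
    HHH.LM_N.pure_tensor_add_left HHH.L_MN.pure_tensor_add_right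
  show ?thesis
    by (rule linear_eq_on_basis[OF HHH.L_MN.tensor_module_module
          linear_maps_comp[OF linear_maps_comp[OF comult_linear L] HHH.tensor_assoc_linear]
          linear_maps_comp[OF comult_linear R] _ _ _ _ assms])
      (simp_all add: comult_basis add pure basis_closed t_closed HHH.LM_N.pure_tensor_closed
        HHH.L_MN.pure_tensor_closed HHH.tensor_assoc_pure HHH.L_MN.T.M.a_ac)
qed

text \<open>The counit and antipode axioms all have this form: a bilinear map applied to the two tensor factors of
  \<open>\<Delta>(h)\<close>, compared with a linear map of \<open>h\<close>.\<close>

lemma lift_comult_eqI:
  assumes b: "\<beta> \<in> bilinear_maps K H H H" and f: "f \<in> linear_maps K H H"
    and "\<beta> \<one>\<^bsub>H\<^esub> \<one>\<^bsub>H\<^esub> = f \<one>\<^bsub>H\<^esub>" "\<beta> g g = f g" "\<beta> y g \<oplus>\<^bsub>H\<^esub> \<beta> \<one>\<^bsub>H\<^esub> y = f y" "\<beta> z \<one>\<^bsub>H\<^esub> \<oplus>\<^bsub>H\<^esub> \<beta> g z = f z"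
    and "h \<in> carrier H"
  shows "tensor_lift K H \<beta> (comult H h) = f h"
  by (rule linear_eq_on_basis[OF H_module
        linear_maps_comp[OF comult_linear HH.tensor_lift_linear[OF H_module b]] f _ _ _ _ assms(7)])
    (simp_all add: comult_basis basis_closed t_closed assms HH.tensor_lift_pure[OF H_module b]
      linear_mapsD(2)[OF HH.tensor_lift_linear[OF H_module b]])

lemma smult_bilinear: "(\<lambda>k u. k \<odot>\<^bsub>H\<^esub> u) \<in> bilinear_maps K (self_algebra K) H H"
  by (intro bilinear_mapsI linear_mapsI)
    (auto simp: self_algebra_sel H.smult_l_distr H.smult_r_distr H.smult_assoc1[symmetric] m_ac)

lemma sweedler_hopf_algebra: "hopf_algebra K H"
proof (intro hopf_algebra.intro hopf_algebra_axioms.intro field_axioms H_algebra comult_hom counit_hom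
    coassoc antipode_linear)
  fix h assume h: "h \<in> carrier H"
  note id = linear_maps_id[of K H]
  note l = bilinear_maps_comp[OF counit_linear id smult_bilinear]
  show "tensor_lift K H (\<lambda>x y. counit H x \<odot>\<^bsub>H\<^esub> y) (comult H h) = h"
    by (rule lift_comult_eqI[OF l id _ _ _ _ h]) (simp_all add: counit_basis basis_closed)
  show "tensor_lift K H (\<lambda>x y. counit H y \<odot>\<^bsub>H\<^esub> x) (comult H h) = h"
    by (rule lift_comult_eqI[OF bilinear_maps_swap[OF l] id _ _ _ _ h]) (simp_all add: counit_basis basis_closed)
  have e: "(\<lambda>h. counit H h \<odot>\<^bsub>H\<^esub> \<one>\<^bsub>H\<^esub>) \<in> linear_maps K H H"
    by (rule linear_maps_comp[OF counit_linear bilinear_mapsD(2)[OF smult_bilinear]]) simp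
  show "tensor_lift K H (\<lambda>x y. antipode H x \<otimes>\<^bsub>H\<^esub> y) (comult H h) = counit H h \<odot>\<^bsub>H\<^esub> \<one>\<^bsub>H\<^esub>"
    by (rule lift_comult_eqI[OF bilinear_maps_comp[OF antipode_linear id mult_bilinear] e _ _ _ _ h])
      (simp_all add: counit_basis basis_closed antipode_basis basis_mult H.M.l_neg H.M.r_neg)
  show "tensor_lift K H (\<lambda>x y. x \<otimes>\<^bsub>H\<^esub> antipode H y) (comult H h) = counit H h \<odot>\<^bsub>H\<^esub> \<one>\<^bsub>H\<^esub>"
    by (rule lift_comult_eqI[OF bilinear_maps_comp[OF id antipode_linear mult_bilinear] e _ _ _ _ h])
      (simp_all add: counit_basis basis_closed antipode_basis basis_mult H.M.l_neg H.M.r_neg H.r_minus)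
qed

end

section \<open>Coactions on commutative parity-graded algebras\<close>

text \<open>The shape of \<open>\<rho>(a) \<rho>(b)\<close>: in the application \<open>x\<close> and \<open>- x\<close> are the contributions of \<open>g y\<close> and \<open>y g\<close>.\<close>

lemma (in abelian_group) cancel_cross_terms:
  assumes "p \<in> carrier G" "q \<in> carrier G" "r \<in> carrier G" "p' \<in> carrier G" "q' \<in> carrier G"
    "r' \<in> carrier G" "x \<in> carrier G"
  shows "(p \<oplus> q \<oplus> r) \<oplus> (q' \<oplus> p' \<oplus> x) \<oplus> (r' \<oplus> \<ominus> x) = (p \<oplus> p') \<oplus> (q \<oplus> q') \<oplus> (r \<oplus> r')"
proof -
  have "(p \<oplus> q \<oplus> r) \<oplus> (q' \<oplus> p' \<oplus> x) \<oplus> (r' \<oplus> \<ominus> x) = (p \<oplus> p') \<oplus> (q \<oplus> q') \<oplus> (r \<oplus> r') \<oplus> (x \<oplus> \<ominus> x)"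
    using assms by (simp add: a_ac)
  then show ?thesis using assms by (simp add: r_neg)
qed

text \<open>A commutative algebra \<open>A\<close> with a grading by parity, given by its projections \<open>ev\<close> and \<open>od\<close> to the even and
  odd parts, together with an odd element \<open>w\<close>. For polynomials \<open>w\<close> will be an odd power of the variable, but
  only its parity matters for the coaction.\<close>

locale parity_graded_coaction = sweedler K mk + A: assoc_algebra K A
  for K :: "('k, 'm) ring_scheme" (structure) and mk :: "'k \<Rightarrow> 'k \<Rightarrow> 'k \<Rightarrow> 'k \<Rightarrow> 'u"
    and A :: "('k, 'a, 'p) module_scheme" +
  fixes ev od :: "'a \<Rightarrow> 'a" and w :: 'a
  assumes A_comm: "\<lbrakk>a \<in> carrier A; b \<in> carrier A\<rbrakk> \<Longrightarrow> a \<otimes>\<^bsub>A\<^esub> b = b \<otimes>\<^bsub>A\<^esub> a"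
    and ev_linear: "ev \<in> linear_maps K A A" and od_linear: "od \<in> linear_maps K A A"
    and parts: "a \<in> carrier A \<Longrightarrow> ev a \<oplus>\<^bsub>A\<^esub> od a = a"
    and ev_od: "a \<in> carrier A \<Longrightarrow> ev (od a) = \<zero>\<^bsub>A\<^esub>" and od_ev: "a \<in> carrier A \<Longrightarrow> od (ev a) = \<zero>\<^bsub>A\<^esub>"
    and ev_mult: "\<lbrakk>a \<in> carrier A; b \<in> carrier A\<rbrakk> \<Longrightarrow>
      ev (a \<otimes>\<^bsub>A\<^esub> b) = ev a \<otimes>\<^bsub>A\<^esub> ev b \<oplus>\<^bsub>A\<^esub> od a \<otimes>\<^bsub>A\<^esub> od b"
    and od_mult: "\<lbrakk>a \<in> carrier A; b \<in> carrier A\<rbrakk> \<Longrightarrow>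
      od (a \<otimes>\<^bsub>A\<^esub> b) = ev a \<otimes>\<^bsub>A\<^esub> od b \<oplus>\<^bsub>A\<^esub> od a \<otimes>\<^bsub>A\<^esub> ev b"
    and od_one: "od \<one>\<^bsub>A\<^esub> = \<zero>\<^bsub>A\<^esub>"
    and w_closed: "w \<in> carrier A" and ev_w: "ev w = \<zero>\<^bsub>A\<^esub>"
begin

lemma ev_closed: "a \<in> carrier A \<Longrightarrow> ev a \<in> carrier A" and od_closed: "a \<in> carrier A \<Longrightarrow> od a \<in> carrier A"
  using linear_mapsD(1)[OF ev_linear] linear_mapsD(1)[OF od_linear] by auto

lemma ev_ev: "a \<in> carrier A \<Longrightarrow> ev (ev a) = ev a"
  using parts[of "ev a"] ev_closed by (simp add: od_ev)

lemma od_od: "a \<in> carrier A \<Longrightarrow> od (od a) = od a"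
  using parts[of "od a"] od_closed by (simp add: ev_od)

lemma od_w: "od w = w"
  using parts[OF w_closed] w_closed od_closed by (simp add: ev_w)

lemma ev_one: "ev \<one>\<^bsub>A\<^esub> = \<one>\<^bsub>A\<^esub>"
  using parts[of "\<one>\<^bsub>A\<^esub>"] ev_closed by (simp add: od_one)

lemma ev_w_od: "a \<in> carrier A \<Longrightarrow> ev (w \<otimes>\<^bsub>A\<^esub> od a) = w \<otimes>\<^bsub>A\<^esub> od a"
  and od_w_od: "a \<in> carrier A \<Longrightarrow> od (w \<otimes>\<^bsub>A\<^esub> od a) = \<zero>\<^bsub>A\<^esub>"
  by (simp_all add: ev_mult od_mult w_closed od_closed ev_closed ev_w od_w ev_od od_od)

sublocale AH: tensor_algebras K A H
  by (intro tensor_algebras.intro H_algebra A.assoc_algebra_axioms)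

sublocale AHH: tensor_triple K A H H
  by (intro tensor_triple.intro HH.tensor_pair_axioms AH.tensor_pair_axioms)

text \<open>The coaction \<open>a \<mapsto> ev(a) \<otimes> 1 + od(a) \<otimes> g\<close> that encodes the grading, deformed by the operator
  \<open>a \<mapsto> w od(a)\<close>, which squares to zero because its values are even.\<close>

definition coaction :: "'a \<Rightarrow> ('a \<times> 'u \<Rightarrow> 'k) set" where
  "coaction a = pure_tensor K A H (ev a) \<one>\<^bsub>H\<^esub> \<oplus>\<^bsub>AH.T\<^esub> pure_tensor K A H (od a) g
    \<oplus>\<^bsub>AH.T\<^esub> pure_tensor K A H (w \<otimes>\<^bsub>A\<^esub> od a) y"

lemmas closed = ev_closed od_closed w_closed basis_closed AH.pure_tensor_closed

lemma coaction_linear: "coaction \<in> linear_maps K A AH.T"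
  by (rule linear_mapsI)
    (simp_all add: coaction_def closed linear_mapsD[OF ev_linear] linear_mapsD[OF od_linear] A.r_distr
      A.smult_mult_right AH.pure_tensor_add_left AH.pure_tensor_smult_left AH.T.smult_r_distr AH.T.M.a_ac)

text \<open>Of the nine products, \<open>y\<^sup>2\<close> contributes zero, and \<open>g y\<close> and \<open>y g\<close> both occur with the left factor
  \<open>w od(a) od(b)\<close> because \<open>A\<close> is commutative, so they cancel. The other six assemble to the even
  and odd parts of \<open>a b\<close>.\<close>

lemma coaction_mult:
  assumes a: "a \<in> carrier A" and b: "b \<in> carrier A"
  shows "coaction (a \<otimes>\<^bsub>A\<^esub> b) = coaction a \<otimes>\<^bsub>tensor_algebra K A H\<^esub> coaction b"
proof -
  let ?t = "pure_tensor K A H"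
  have comm: "od a \<otimes>\<^bsub>A\<^esub> (w \<otimes>\<^bsub>A\<^esub> od b) = w \<otimes>\<^bsub>A\<^esub> (od a \<otimes>\<^bsub>A\<^esub> od b)"
    "ev a \<otimes>\<^bsub>A\<^esub> (w \<otimes>\<^bsub>A\<^esub> od b) = w \<otimes>\<^bsub>A\<^esub> (ev a \<otimes>\<^bsub>A\<^esub> od b)"
    using a b by (simp_all add: closed A.m_assoc[symmetric] A_comm[of _ w])
  have "coaction a \<otimes>\<^bsub>tensor_algebra K A H\<^esub> coaction b =
    (?t (ev a \<otimes>\<^bsub>A\<^esub> ev b) \<one>\<^bsub>H\<^esub> \<oplus>\<^bsub>AH.T\<^esub> ?t (ev a \<otimes>\<^bsub>A\<^esub> od b) g \<oplus>\<^bsub>AH.T\<^esub> ?t (w \<otimes>\<^bsub>A\<^esub> (ev a \<otimes>\<^bsub>A\<^esub> od b)) y) \<oplus>\<^bsub>AH.T\<^esub>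
    (?t (od a \<otimes>\<^bsub>A\<^esub> ev b) g \<oplus>\<^bsub>AH.T\<^esub> ?t (od a \<otimes>\<^bsub>A\<^esub> od b) \<one>\<^bsub>H\<^esub> \<oplus>\<^bsub>AH.T\<^esub> ?t (w \<otimes>\<^bsub>A\<^esub> (od a \<otimes>\<^bsub>A\<^esub> od b)) z) \<oplus>\<^bsub>AH.T\<^esub>
    (?t (w \<otimes>\<^bsub>A\<^esub> (od a \<otimes>\<^bsub>A\<^esub> ev b)) y \<oplus>\<^bsub>AH.T\<^esub> \<ominus>\<^bsub>AH.T\<^esub> ?t (w \<otimes>\<^bsub>A\<^esub> (od a \<otimes>\<^bsub>A\<^esub> od b)) z)"
    using a b
    by (simp add: coaction_def closed AH.tensor_mult_distrib AH.tensor_mult_pure basis_mult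
        AH.pure_tensor_neg_right AH.pure_tensor_zero_right A.m_assoc comm AH.T.M.a_ac)
  also have "\<dots> = coaction (a \<otimes>\<^bsub>A\<^esub> b)"
    using a b
    by (subst AH.T.M.cancel_cross_terms)
      (simp_all add: coaction_def closed ev_mult od_mult AH.pure_tensor_add_left A.r_distr)
  finally show ?thesis by simp
qed

lemma coaction_hom: "coaction \<in> algebra_hom K A (tensor_algebra K A H)"
proof -
  have "coaction \<one>\<^bsub>A\<^esub> = pure_tensor K A H \<one>\<^bsub>A\<^esub> \<one>\<^bsub>H\<^esub>"
    by (simp add: coaction_def ev_one od_one closed AH.pure_tensor_zero_left)
  then show ?thesis
    using linear_mapsD[OF coaction_linear]
    by (auto simp: algebra_hom_def linear_maps_tensor_algebra coaction_linear ring_hom_def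
        tensor_algebra_sel coaction_mult)
qed

text \<open>Even elements are coinvariant. The third equation is where the oddness of \<open>w\<close> is used: it makes
  \<open>w od(a)\<close> even.\<close>

lemma coaction_parts:
  assumes "a \<in> carrier A"
  shows "coaction (ev a) = pure_tensor K A H (ev a) \<one>\<^bsub>H\<^esub>"
    and "coaction (od a) = pure_tensor K A H (od a) g \<oplus>\<^bsub>AH.T\<^esub> pure_tensor K A H (w \<otimes>\<^bsub>A\<^esub> od a) y"
    and "coaction (w \<otimes>\<^bsub>A\<^esub> od a) = pure_tensor K A H (w \<otimes>\<^bsub>A\<^esub> od a) \<one>\<^bsub>H\<^esub>"
  using assms
  by (simp_all add: coaction_def ev_ev od_ev ev_od od_od ev_w_od od_w_od closed AH.pure_tensor_zero_left)

text \<open>By \<open>coaction_parts\<close> the left hand side is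
  \<open>ev(a) \<otimes> 1 \<otimes> 1 + od(a) \<otimes> g \<otimes> g + w od(a) \<otimes> (y \<otimes> g + 1 \<otimes> y)\<close>, in which \<open>\<Delta>\<close> of \<open>1\<close>, \<open>g\<close> and \<open>y\<close> can be read off.\<close>

lemma coaction_coassoc:
  assumes a: "a \<in> carrier A"
  shows "tensor_assoc K A H H (tensor_map K AH.T H coaction (\<lambda>h. h) (coaction a)) =
    tensor_map K A HH (\<lambda>x. x) (comult H) (coaction a)"
proof -
  note idH = linear_maps_id[of K H] and idA = linear_maps_id[of K A]
  note L = AHH.LM_N.tensor_map_linear[OF A.module_axioms H_module coaction_linear idH]
  note R = AHH.L_MN.tensor_map_linear[OF A.module_axioms H_module idA comult_linear]
  note pure = AHH.LM_N.tensor_map_pure[OF A.module_axioms H_module coaction_linear idH]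
    AHH.L_MN.tensor_map_pure[OF A.module_axioms H_module idA comult_linear]
  note add = linear_mapsD(2)[OF L] linear_mapsD(2)[OF R] linear_mapsD(2)[OF AHH.tensor_assoc_linear]
    AHH.LM_N.pure_tensor_add_left AHH.L_MN.pure_tensor_add_right
  have "coaction a = pure_tensor K A H (ev a) \<one>\<^bsub>H\<^esub> \<oplus>\<^bsub>AH.T\<^esub> pure_tensor K A H (od a) g
    \<oplus>\<^bsub>AH.T\<^esub> pure_tensor K A H (w \<otimes>\<^bsub>A\<^esub> od a) y" by (simp add: coaction_def)
  then show ?thesis using a
    by (simp add: coaction_parts comult_basis add pure closed t_closed AHH.LM_N.pure_tensor_closed
        AHH.L_MN.pure_tensor_closed AHH.tensor_assoc_pure AHH.L_MN.T.M.a_ac)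
qed

lemma coaction_counit:
  assumes a: "a \<in> carrier A"
  shows "tensor_lift K A (\<lambda>x h. counit H h \<odot>\<^bsub>A\<^esub> x) (coaction a) = a"
proof -
  have "(\<lambda>k x. k \<odot>\<^bsub>A\<^esub> x) \<in> bilinear_maps K (self_algebra K) A A"
    by (intro bilinear_mapsI linear_mapsI)
      (auto simp: self_algebra_sel A.smult_l_distr A.smult_r_distr A.smult_assoc1[symmetric] m_ac)
  then have b: "(\<lambda>x h. counit H h \<odot>\<^bsub>A\<^esub> x) \<in> bilinear_maps K A H A"
    by (rule bilinear_maps_swap[OF bilinear_maps_comp[OF counit_linear linear_maps_id]])
  show ?thesis using a
    by (simp add: coaction_def closed linear_mapsD[OF AH.tensor_lift_linear[OF A.module_axioms b]]
        AH.tensor_lift_pure[OF A.module_axioms b] counit_basis parts)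
qed

lemma coaction_unital: "unital_coaction K A H coaction"
  unfolding unital_coaction_def comodule_map_def
  using coaction_hom coaction_linear coaction_coassoc coaction_counit by blast

end

section \<open>Even and odd parts of polynomials\<close>

context UP_cring
begin

lemma UP_assoc_algebra: "assoc_algebra R P"
proof (intro assoc_algebra.intro assoc_algebra_axioms.intro module_axioms P.ring_axioms UP_smult_assoc2)
  fix c p q assume *: "c \<in> carrier R" "p \<in> carrier P" "q \<in> carrier P"
  then have "p \<otimes>\<^bsub>P\<^esub> (c \<odot>\<^bsub>P\<^esub> q) = (c \<odot>\<^bsub>P\<^esub> q) \<otimes>\<^bsub>P\<^esub> p" by (intro P.m_comm) simp_all
  also have "\<dots> = c \<odot>\<^bsub>P\<^esub> (q \<otimes>\<^bsub>P\<^esub> p)" using * by (intro UP_smult_assoc2)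
  also have "q \<otimes>\<^bsub>P\<^esub> p = p \<otimes>\<^bsub>P\<^esub> q" using * by (intro P.m_comm)
  finally show "p \<otimes>\<^bsub>P\<^esub> (c \<odot>\<^bsub>P\<^esub> q) = c \<odot>\<^bsub>P\<^esub> (p \<otimes>\<^bsub>P\<^esub> q)" .
qed

text \<open>The Boolean is the parity to keep, so that the product rule for the even and the odd part is one formula.\<close>

definition parity_part :: "bool \<Rightarrow> (nat \<Rightarrow> 'a) \<Rightarrow> nat \<Rightarrow> 'a"
  where "parity_part e p = (\<lambda>n. if even n = e then p n else \<zero>)"

lemma parity_part_closed: "p \<in> carrier P \<Longrightarrow> parity_part e p \<in> carrier P"
proof -
  assume p: "p \<in> carrier P"
  then obtain b where "bound \<zero> b p" by (auto simp: UP_def P_def)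
  then have "bound \<zero> b (parity_part e p)" by (auto simp: parity_part_def)
  then show ?thesis using p by (auto simp: UP_def P_def parity_part_def intro!: mem_upI)
qed

lemma coeff_parity_part:
  "p \<in> carrier P \<Longrightarrow> coeff P (parity_part e p) n = (if even n = e then coeff P p n else \<zero>)"
  using parity_part_closed[of p e] by (simp add: UP_def P_def) (simp add: parity_part_def)

lemma parity_part_linear: "parity_part e \<in> linear_maps R P P"
  by (intro linear_mapsI up_eqI) (simp_all add: parity_part_closed coeff_parity_part)

lemma parity_parts: "p \<in> carrier P \<Longrightarrow> parity_part True p \<oplus>\<^bsub>P\<^esub> parity_part False p = p"
  by (rule up_eqI) (simp_all add: parity_part_closed coeff_parity_part)

lemma parity_part_other: "p \<in> carrier P \<Longrightarrow> e \<noteq> e' \<Longrightarrow> parity_part e (parity_part e' p) = \<zero>\<^bsub>P\<^esub>"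
  by (rule up_eqI) (simp_all add: parity_part_closed coeff_parity_part)

lemma parity_part_monom:
  "parity_part e (monom P \<one> n) = (if even n = e then monom P \<one> n else \<zero>\<^bsub>P\<^esub>)"
  by (rule up_eqI) (simp_all add: parity_part_closed coeff_parity_part)

text \<open>In the \<open>n\<close>-th coefficient of the product, the term with index \<open>i\<close> belongs to exactly one of the two summands
  on the right, according to the parity of \<open>i\<close>.\<close>

lemma parity_part_mult:
  assumes p: "p \<in> carrier P" and q: "q \<in> carrier P"
  shows "parity_part e (p \<otimes>\<^bsub>P\<^esub> q) =
    parity_part True p \<otimes>\<^bsub>P\<^esub> parity_part e q \<oplus>\<^bsub>P\<^esub> parity_part False p \<otimes>\<^bsub>P\<^esub> parity_part (\<not> e) q"
proof (rule up_eqI)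
  fix n
  note cl = parity_part_closed[OF p] parity_part_closed[OF q]
  let ?f = "\<lambda>i. coeff P (parity_part True p) i \<otimes> coeff P (parity_part e q) (n - i)"
  let ?h = "\<lambda>i. coeff P (parity_part False p) i \<otimes> coeff P (parity_part (\<not> e) q) (n - i)"
  have "coeff P (parity_part e (p \<otimes>\<^bsub>P\<^esub> q)) n =
      (if even n = e then \<Oplus>i\<in>{..n}. coeff P p i \<otimes> coeff P q (n - i) else \<zero>)"
    using p q by (simp add: coeff_parity_part)
  also have "\<dots> = (\<Oplus>i\<in>{..n}. if even n = e then coeff P p i \<otimes> coeff P q (n - i) else \<zero>)"
    by simp
  also have "\<dots> = (\<Oplus>i\<in>{..n}. ?f i \<oplus> ?h i)"
    by (rule R.finsum_cong') (use p q in \<open>auto simp: coeff_parity_part even_diff_nat\<close>)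
  also have "\<dots> = (\<Oplus>i\<in>{..n}. ?f i) \<oplus> (\<Oplus>i\<in>{..n}. ?h i)"
    by (rule R.finsum_addf) (use p q cl in \<open>auto\<close>)
  also have "\<dots> = coeff P (parity_part True p \<otimes>\<^bsub>P\<^esub> parity_part e q \<oplus>\<^bsub>P\<^esub> parity_part False p \<otimes>\<^bsub>P\<^esub> parity_part (\<not> e) q) n"
    by (simp add: cl)
  finally show "coeff P (parity_part e (p \<otimes>\<^bsub>P\<^esub> q)) n =
    coeff P (parity_part True p \<otimes>\<^bsub>P\<^esub> parity_part e q \<oplus>\<^bsub>P\<^esub> parity_part False p \<otimes>\<^bsub>P\<^esub> parity_part (\<not> e) q) n" .
qed (simp_all add: p q parity_part_closed)

section \<open>Degrees in tensor products with polynomials\<close>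

text \<open>The coefficient of \<open>x\<^sup>n\<close> of an element of \<open>k[x] \<otimes> N\<close>, regarded as a polynomial with coefficients in \<open>N\<close>.\<close>

definition tensor_coeff ::
  "('a, 'n, 'q) module_scheme \<Rightarrow> nat \<Rightarrow> ((nat \<Rightarrow> 'a) \<times> 'n \<Rightarrow> 'a) set \<Rightarrow> 'n"
  where "tensor_coeff N n = tensor_lift R N (\<lambda>p v. coeff P p n \<odot>\<^bsub>N\<^esub> v)"

context
  fixes N :: "('a, 'n, 'q) module_scheme"
  assumes N: "module R N"
begin

interpretation N: module R N by (rule N)
interpretation PN: tensor_pair R P N by (intro tensor_pair.intro module_axioms N)

lemma coeff_smult_bilinear: "(\<lambda>p v. coeff P p n \<odot>\<^bsub>N\<^esub> v) \<in> bilinear_maps R P N N"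
  by (intro bilinear_mapsI linear_mapsI)
    (auto simp: N.smult_l_distr N.smult_r_distr N.smult_assoc1[symmetric] R.m_ac)

lemma tensor_coeff_linear: "tensor_coeff N n \<in> linear_maps R (tensor_module R P N) N"
  unfolding tensor_coeff_def by (rule PN.tensor_lift_linear[OF N coeff_smult_bilinear])

lemma tensor_coeff_pure:
  "\<lbrakk>p \<in> carrier P; v \<in> carrier N\<rbrakk> \<Longrightarrow> tensor_coeff N n (pure_tensor R P N p v) = coeff P p n \<odot>\<^bsub>N\<^esub> v"
  unfolding tensor_coeff_def by (rule PN.tensor_lift_pure[OF N coeff_smult_bilinear])

text \<open>A tensor is a finite sum of pure tensors, each of which has the degree of its polynomial as a bound.\<close>

lemma tensor_degree_bounded:
  assumes "t \<in> carrier (tensor_module R P N)"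
  shows "\<exists>b. \<forall>n>b. tensor_coeff N n t = \<zero>\<^bsub>N\<^esub>"
  using assms
proof (induction rule: PN.tensor_induct)
  case zero
  show ?case using linear_map_zero[OF PN.tensor_module_module N tensor_coeff_linear] by blast
next
  case (step p v s)
  then obtain b where b: "\<forall>n>b. tensor_coeff N n s = \<zero>\<^bsub>N\<^esub>" by blast
  have "tensor_coeff N n (pure_tensor R P N p v \<oplus>\<^bsub>tensor_module R P N\<^esub> s) = \<zero>\<^bsub>N\<^esub>"
    if "n > max b (deg R p)" for n
    using that b step(1-3)
    by (simp add: linear_mapsD[OF tensor_coeff_linear] PN.pure_tensor_closed tensor_coeff_pure deg_aboveD)
  then show ?case by blast
qed

end

text \<open>A map applied to the coefficients cannot raise the degree; this transfers the bound from the universal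
  coaction to every other one.\<close>

lemma tensor_coeff_natural:
  assumes N: "module R N" and N': "module R N'" and \<phi>: "\<phi> \<in> linear_maps R N N'"
    and t: "t \<in> carrier (tensor_module R P N)"
  shows "tensor_coeff N' n (tensor_map R P N' (\<lambda>p. p) \<phi> t) = \<phi> (tensor_coeff N n t)"
proof -
  interpret PN: tensor_pair R P N by (intro tensor_pair.intro module_axioms N)
  interpret PN': tensor_pair R P N' by (intro tensor_pair.intro module_axioms N')
  note map = PN'.tensor_map_linear[OF module_axioms N linear_maps_id \<phi>]
    PN'.tensor_map_pure[OF module_axioms N linear_maps_id \<phi>]
  show ?thesis
    by (rule PN.tensor_linear_eqI[OF N' linear_maps_comp[OF map(1) tensor_coeff_linear[OF N']]
          linear_maps_comp[OF tensor_coeff_linear[OF N] \<phi>] _ t])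
      (simp add: map(2) tensor_coeff_pure N N' linear_mapsD[OF \<phi>])
qed

end

section \<open>Nonexistence of the universal coaction\<close>

theorem theorem6p1:
  fixes K :: "('k, 'm) ring_scheme"
  assumes "field K"
    and universe: "\<exists>\<iota> :: (nat \<Rightarrow> 'k) \<Rightarrow> 'u. inj_on \<iota> (carrier (UP K))"
  shows "\<not> (\<exists>(H0 :: ('k, 'h) hopf) (\<rho>0 :: (nat \<Rightarrow> 'k) \<Rightarrow> ((nat \<Rightarrow> 'k) \<times> 'h \<Rightarrow> 'k) set).
    universal_coacting_hopf_algebra TYPE('u) K (UP K) H0 \<rho>0)"
proof (rule notI, elim exE)
  fix H0 :: "('k, 'h) hopf" and \<rho>0 :: "(nat \<Rightarrow> 'k) \<Rightarrow> ((nat \<Rightarrow> 'k) \<times> 'h \<Rightarrow> 'k) set"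
  assume univ: "universal_coacting_hopf_algebra TYPE('u) K (UP K) H0 \<rho>0"
  interpret K: field K by fact
  interpret UP: UP_cring K "UP K" by (simp add: UP_cring_def K.is_cring)
  interpret H0: hopf_algebra K H0
    using univ by (simp add: universal_coacting_hopf_algebra_def)
  let ?P = "UP K"
  let ?x = "monom ?P \<one>\<^bsub>K\<^esub> (Suc 0)"
  obtain \<iota> :: "(nat \<Rightarrow> 'k) \<Rightarrow> 'u" where \<iota>: "inj_on \<iota> (carrier ?P)" using universe by blast
  \<comment> \<open>Four coordinates are stored as the coefficients of a polynomial of degree at most three, which \<open>\<iota>\<close> then sends into the universe.\<close>
  define vec where "vec a b c d = (\<lambda>n::nat. if n = 0 then a else if n = 1 then b else if n = 2 then c
    else if n = 3 then d else \<zero>\<^bsub>K\<^esub>)" for a b c d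
  have vec: "vec a b c d \<in> carrier ?P"
    if "a \<in> carrier K" "b \<in> carrier K" "c \<in> carrier K" "d \<in> carrier K" for a b c d
    using that by (auto simp: UP_def vec_def intro!: exI[of _ 3])
  have vec_inject: "a = a' \<and> b = b' \<and> c = c' \<and> d = d'" if "vec a b c d = vec a' b' c' d'" for a b c d a' b' c' d'
    using fun_cong[OF that, of 0] fun_cong[OF that, of 1] fun_cong[OF that, of 2] fun_cong[OF that, of 3]
    by (simp add: vec_def)
  define mk where "mk a b c d = \<iota> (vec a b c d)" for a b c d
  interpret S: sweedler K mk
    by unfold_locales (auto simp: mk_def dest!: inj_onD[OF \<iota>] vec_inject intro: vec)
  have \<rho>0_x: "\<rho>0 ?x \<in> carrier (tensor_module K ?P H0)"
    using univ by (auto simp: universal_coacting_hopf_algebra_def unital_coaction_def comodule_map_def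
        linear_maps_def)
  from UP.tensor_degree_bounded[OF H0.module_axioms \<rho>0_x] obtain b
    where b: "\<And>n. n > b \<Longrightarrow> UP.tensor_coeff H0 n (\<rho>0 ?x) = \<zero>\<^bsub>H0\<^esub>" by blast
  \<comment> \<open>The exponent is odd, and it exceeds \<open>b\<close>, so \<open>w x\<close> lies beyond the degree bound.\<close>
  define w where "w = monom ?P \<one>\<^bsub>K\<^esub> (2 * b + 1)"
  have w: "w \<in> carrier ?P" "UP.parity_part True w = \<zero>\<^bsub>?P\<^esub>"
    by (simp_all add: w_def UP.parity_part_monom)
  have w_x: "w \<otimes>\<^bsub>?P\<^esub> ?x = monom ?P \<one>\<^bsub>K\<^esub> (2 * b + 2)"
    using UP.monom_mult[of "\<one>\<^bsub>K\<^esub>" "\<one>\<^bsub>K\<^esub>" "2 * b + 1" "Suc 0"] by (simp add: w_def)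
  interpret C: parity_graded_coaction K mk ?P "UP.parity_part True" "UP.parity_part False" w
    by (intro parity_graded_coaction.intro parity_graded_coaction_axioms.intro UP.UP_assoc_algebra
        S.sweedler_axioms UP.parity_part_linear)
      (simp_all add: UP.P.m_comm UP.parity_parts UP.parity_part_other UP.parity_part_mult
        UP.parity_part_monom w flip: UP.monom_one)
  have "\<exists>\<phi>. \<phi> \<in> hopf_hom K H0 S.H \<and>
      (\<forall>a\<in>carrier ?P. C.coaction a = tensor_map K ?P S.H (\<lambda>x. x) \<phi> (\<rho>0 a))"
    using univ S.sweedler_hopf_algebra C.coaction_unital
    unfolding universal_coacting_hopf_algebra_def by blast
  then obtain \<phi> where \<phi>: "\<phi> \<in> linear_maps K H0 S.H"
    and eq: "C.coaction ?x = tensor_map K ?P S.H (\<lambda>x. x) \<phi> (\<rho>0 ?x)"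
    by (auto simp: hopf_hom_def algebra_hom_def)
  have "UP.tensor_coeff S.H (2 * b + 2) (C.coaction ?x) = \<zero>\<^bsub>S.H\<^esub>"
    unfolding eq using b[of "2 * b + 2"] linear_map_zero[OF H0.module_axioms S.H_module \<phi>]
    by (subst UP.tensor_coeff_natural[OF H0.module_axioms S.H_module \<phi>]) (simp_all add: \<rho>0_x)
  moreover have "UP.tensor_coeff S.H (2 * b + 2) (C.coaction ?x) = S.y"
    using linear_mapsD(2)[OF UP.tensor_coeff_linear[OF S.H_module]]
    by (simp add: C.coaction_def C.closed UP.tensor_coeff_pure[OF S.H_module] UP.parity_part_monom w_x)
  ultimately have "S.y = \<zero>\<^bsub>S.H\<^esub>" by simp
  then show False
    using S.mk_inject[of "\<zero>\<^bsub>K\<^esub>" "\<zero>\<^bsub>K\<^esub>" "\<one>\<^bsub>K\<^esub>" "\<zero>\<^bsub>K\<^esub>" "\<zero>\<^bsub>K\<^esub>" "\<zero>\<^bsub>K\<^esub>" "\<zero>\<^bsub>K\<^esub>" "\<zero>\<^bsub>K\<^esub>"]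
    by (simp add: S.mk_zero)
qed

end
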